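(* Let $a>0$ and let $p,q:\mathbb{R}\to\mathbb{R}$ be real functions with $p\in C^1(\mathbb{R})$ and $$\int_{\mathbb{R}}|q(x)|^2e^{2a|x|}dx<\infty,\quad \int_{\mathbb{R}}|p(x)|^2e^{2a|x|}dx<\infty,\quad \int_{\mathbb{R}}|p'(x)|^2e^{2a|x|}dx<\infty .$$ Let $\mathbb{D}_0(a/2)=\{\lambda\in\mathbb{C}:\lambda\neq0,\ |\lambda|<a/2\}$. Then for all $\lambda\in\mathbb{D}_0(a/2)$ and $k\in\{0,1,2\}$ there exist Jost solutions at $+\infty$, i.e. solutions $v_k(\lambda,x)$ $(x\in\mathbb{R})$ of the equation $$y'''(x)=i\lambda^3y(x)+2p(x)y'(x)+[p'(x)+iq(x)]y(x)\qquad(x\in\mathbb{R})$$ such that $v_k(\lambda,x)-e^{-i\lambda\zeta_kx}\to0$ as $x\to+\infty$, and they are given by $$v_k(\lambda,x)=e^{-i\lambda\zeta_kx}-\int_x^\infty\frac{s_2(-i\lambda(x-t))}{(-i\lambda)^2}w_k(\lambda,t)\,dt,$$ where $w_k(\lambda,x)$ is a solution of the integral equation $$w_k(\lambda,x)=g_k(\lambda,x)-\int_x^\infty K_1(\lambda,x,t)w_k(\lambda,t)\,dt .$$ Moreover, the functions $v_k(\lambda,x)$ and $w_k(\lambda,x)$ $(k=0,1,2)$ are holomorphic in $\lambda\in\mathbb{D}_0(a/2)$ (for each fixed $x\in\mathbb{R}$).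
   Context: Notation: $\zeta_0=1$, $\zeta_1=-\frac12+i\frac{\sqrt3}2$, $\zeta_2=-\frac12-i\frac{\sqrt3}2$ are the cube roots of $1$, and $$s_r(z)=\frac13\sum_{k=0}^2\frac1{\zeta_k^r}e^{z\zeta_k}\qquad(r=0,1,2,\ z\in\mathbb{C}).$$ The kernel and the free term of the integral equation are $$K_1(\lambda,x,t)=\frac{s_2(-i\lambda(x-t))}{(-i\lambda)^2}\,[p'(x)+iq(x)]+\frac{s_1(-i\lambda(x-t))}{-i\lambda}\,2p(x),$$ $$g_k(\lambda,x)=e^{-i\lambda\zeta_kx}\{p'(x)+iq(x)-2i\lambda\zeta_kp(x)\}.$$ Since $q$ is only assumed measurable, a solution $y$ of the third-order differential equation means a function with $y''$ locally absolutely continuous satisfying the equation almost everywhere. *)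

theory Defs
  imports "HOL-Analysis.Analysis"
begin

text \<open>The cube roots of unity, meant for indices \<open>k \<in> {0, 1, 2}\<close>.\<close>

definition zeta :: "nat \<Rightarrow> complex" where
  "zeta k = (if k = 0 then 1
             else if k = 1 then - 1 / 2 + \<i> * (of_real (sqrt 3) / 2)
             else - 1 / 2 - \<i> * (of_real (sqrt 3) / 2))"

definition sfun :: "nat \<Rightarrow> complex \<Rightarrow> complex" where
  "sfun r z = 1 / 3 * (\<Sum>k\<le>2. 1 / zeta k ^ r * exp (z * zeta k))"

text \<open>In the following definitions the derivative of \<open>p\<close> is \<^term>\<open>deriv p\<close>,
  which is the genuine derivative once \<open>p\<close> is differentiable.\<close>

definition kernel1 ::
  "(real \<Rightarrow> real) \<Rightarrow> (real \<Rightarrow> real) \<Rightarrow> complex \<Rightarrow> real \<Rightarrow> real \<Rightarrow> complex" where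
  "kernel1 p q l x t =
     sfun 2 (- \<i> * l * of_real (x - t)) / (- \<i> * l)\<^sup>2 * (of_real (deriv p x) + \<i> * of_real (q x))
     + sfun 1 (- \<i> * l * of_real (x - t)) / (- \<i> * l) * (2 * of_real (p x))"

definition free_term ::
  "(real \<Rightarrow> real) \<Rightarrow> (real \<Rightarrow> real) \<Rightarrow> nat \<Rightarrow> complex \<Rightarrow> real \<Rightarrow> complex" where
  "free_term p q k l x =
     exp (- \<i> * l * zeta k * of_real x)
     * (of_real (deriv p x) + \<i> * of_real (q x) - 2 * \<i> * l * zeta k * of_real (p x))"

definition abs_continuous_on_interval :: "real \<Rightarrow> real \<Rightarrow> (real \<Rightarrow> complex) \<Rightarrow> bool" where
  "abs_continuous_on_interval b c f \<longleftrightarrow>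
     (\<forall>\<epsilon>>0. \<exists>\<delta>>0. \<forall>(n::nat) u v.
        (\<forall>i<n. b \<le> u i \<and> u i \<le> v i \<and> v i \<le> c) \<longrightarrow>
        disjoint_family_on (\<lambda>i. {u i<..<v i}) {..<n} \<longrightarrow>
        (\<Sum>i<n. v i - u i) < \<delta> \<longrightarrow>
        (\<Sum>i<n. norm (f (v i) - f (u i))) < \<epsilon>)"

definition locally_abs_continuous :: "(real \<Rightarrow> complex) \<Rightarrow> bool" where
  "locally_abs_continuous f \<longleftrightarrow> (\<forall>b c. b \<le> c \<longrightarrow> abs_continuous_on_interval b c f)"

text \<open>Solutions of \<open>y''' = i \<lambda>\<^sup>3 y + 2 p y' + (p' + i q) y\<close> on the real line;
  \<open>y1\<close> and \<open>y2\<close> stand for \<open>y'\<close> and \<open>y''\<close>. The coefficient \<open>q\<close> is only measurable,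
  so the equation is required almost everywhere.\<close>

definition ode_solution ::
  "(real \<Rightarrow> real) \<Rightarrow> (real \<Rightarrow> real) \<Rightarrow> complex \<Rightarrow> (real \<Rightarrow> complex) \<Rightarrow> bool" where
  "ode_solution p q l y \<longleftrightarrow>
     (\<exists>y1 y2. (\<forall>x. (y has_vector_derivative y1 x) (at x)) \<and>
              (\<forall>x. (y1 has_vector_derivative y2 x) (at x)) \<and>
              locally_abs_continuous y2 \<and>
              (AE x in lebesgue. (y2 has_vector_derivative
                 (\<i> * l ^ 3 * y x + 2 * of_real (p x) * y1 x
                  + (of_real (deriv p x) + \<i> * of_real (q x)) * y x)) (at x)))"

definition jost_solution ::
  "(real \<Rightarrow> real) \<Rightarrow> (real \<Rightarrow> real) \<Rightarrow> nat \<Rightarrow> complex \<Rightarrow> (real \<Rightarrow> complex) \<Rightarrow> bool" where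
  "jost_solution p q k l y \<longleftrightarrow>
     ode_solution p q l y \<and>
     ((\<lambda>x. y x - exp (- \<i> * l * zeta k * of_real x)) \<longlongrightarrow> 0) at_top"

text \<open>In the next two definitions the integrals are required to converge absolutely,
  because the Bochner integral of a non-integrable function is \<open>0\<close> by convention.\<close>

definition integral_eq_solution ::
  "(real \<Rightarrow> real) \<Rightarrow> (real \<Rightarrow> real) \<Rightarrow> nat \<Rightarrow> complex \<Rightarrow> (real \<Rightarrow> complex) \<Rightarrow> bool" where
  "integral_eq_solution p q k l w \<longleftrightarrow>
     (\<forall>x. set_integrable lebesgue {x..} (\<lambda>t. kernel1 p q l x t * w t) \<and>
          w x = free_term p q k l x - (LINT t:{x..}|lebesgue. kernel1 p q l x t * w t))"

definition given_by_integral ::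
  "nat \<Rightarrow> complex \<Rightarrow> (real \<Rightarrow> complex) \<Rightarrow> (real \<Rightarrow> complex) \<Rightarrow> bool" where
  "given_by_integral k l w y \<longleftrightarrow>
     (\<forall>x. set_integrable lebesgue {x..}
            (\<lambda>t. sfun 2 (- \<i> * l * of_real (x - t)) / (- \<i> * l)\<^sup>2 * w t) \<and>
          y x = exp (- \<i> * l * zeta k * of_real x)
            - (LINT t:{x..}|lebesgue. sfun 2 (- \<i> * l * of_real (x - t)) / (- \<i> * l)\<^sup>2 * w t))"

definition punctured_disc :: "real \<Rightarrow> complex set" where
  "punctured_disc r = {l. l \<noteq> 0 \<and> norm l < r}"

end

theory Submission
  imports Defs "HOL-Complex_Analysis.Cauchy_Integral_Formula"
begin

text \<open>
  Put \<open>\<nu>\<^sub>j = -i \<lambda> \<zeta>\<^sub>j\<close>, so that \<open>\<nu>\<^sub>j\<^sup>3 = i \<lambda>\<^sup>3\<close> and the unperturbed equation \<open>y''' = i \<lambda>\<^sup>3 y\<close> is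
  solved by the three functions \<open>exp (\<nu>\<^sub>j x)\<close>. The kernel \<open>s\<^sub>2 (-i \<lambda> s) / (-i \<lambda>)\<^sup>2\<close> is its solution
  with the initial values \<open>0, 0, 1\<close>. Variation of constants from \<open>+\<infinity>\<close> turns the differential
  equation into an integral equation for the perturbation \<open>w = (p' + i q) v + 2 p v'\<close>, which is
  of Volterra type on the half lines \<open>[x, \<infinity>)\<close>.

  On an annulus \<open>d < |\<lambda>| < r\<close> with \<open>r < a / 2\<close>, write \<open>m = |p'| + |q| + |p|\<close>. The kernel is
  bounded by \<open>C m(x) exp (r (t - x))\<close> and the free term by a multiple of \<open>\<rho>(x) = m(x) exp (r |x|)\<close>.
  Relative to the weight \<open>\<rho>\<close> the kernel is therefore dominated by \<open>h(t) = C m(t) exp (2 r |t|)\<close>,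
  a function of \<open>t\<close> alone, and \<open>h\<close> is integrable because \<open>2 r < a\<close> (\<open>integrable_weight_improvement\<close>). If \<open>M(x)\<close> denotes the integral of \<open>h\<close> over \<open>[x, \<infinity>)\<close>, the integral operator halves
  the supremum norm with weight \<open>\<rho>(x) exp (4 M(x))\<close> (\<open>tail_integral_exp_weight\<close>, \<open>operator_contraction\<close>).
  Hence the Picard iterates converge geometrically, for fixed \<open>x\<close> uniformly in \<open>\<lambda>\<close> on the annulus. Each iterate
  is holomorphic in \<open>\<lambda>\<close> (\<open>holomorphic_on_integral\<close>), so the limit \<open>w\<close> is, and then so is \<open>v\<close>. The iterates
  do not depend on \<open>d\<close> and \<open>r\<close>, and the annuli cover the punctured disc.

  To return from \<open>w\<close> to the differential equation, the kernels are written as sums of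
  exponentials. Then \<open>v\<close> and its derivatives are combinations of \<open>exp (\<nu>\<^sub>j x)\<close> with the tail
  integrals of the integrable functions \<open>exp (-\<nu>\<^sub>j t) w(t)\<close>. Differentiating such a combination
  produces the same kind of combination, with coefficients multiplied by \<open>\<nu>\<^sub>j\<close>, and a boundary
  term, the sum of the coefficients times \<open>w\<close>. For \<open>v\<close> and \<open>v'\<close> this sum is \<open>0\<close> and the derivative exists
  everywhere (\<open>conv_derivative\<close>). For \<open>v''\<close> the sum is \<open>1\<close> and the derivative exists at almost every point
  by Lebesgue's differentiation theorem (\<open>AE_conv_derivative\<close>); the boundary term is then
  the perturbation.
\<close>

section \<open>Integrals over half lines\<close>

lemma has_vector_derivative_iff_quotient:
  fixes f :: "real \<Rightarrow> 'b::real_normed_vector"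
  shows "(f has_vector_derivative D) (at x within S)
    \<longleftrightarrow> ((\<lambda>y. (f y - f x) /\<^sub>R (y - x)) \<longlongrightarrow> D) (at x within S)"
proof -
  have eq: "norm ((1 / norm (y - x)) *\<^sub>R (f y - (f x + (y - x) *\<^sub>R D))) = norm ((f y - f x) /\<^sub>R (y - x) - D)"
    if "y \<noteq> x" for y
  proof -
    have "f y - (f x + (y - x) *\<^sub>R D) = (y - x) *\<^sub>R ((f y - f x) /\<^sub>R (y - x) - D)"
      using that by (simp add: scaleR_diff_right)
    then show ?thesis using that by simp
  qed
  have "(f has_vector_derivative D) (at x within S)
      \<longleftrightarrow> ((\<lambda>y. norm ((1 / norm (y - x)) *\<^sub>R (f y - (f x + (y - x) *\<^sub>R D)))) \<longlongrightarrow> 0) (at x within S)"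
    unfolding has_vector_derivative_def has_derivative_within tendsto_norm_zero_iff
    by (simp add: bounded_linear_scaleR_left)
  also have "\<dots> \<longleftrightarrow> ((\<lambda>y. norm ((f y - f x) /\<^sub>R (y - x) - D)) \<longlongrightarrow> 0) (at x within S)"
    by (intro filterlim_cong refl)
       (unfold eventually_at_filter, intro always_eventually allI impI, rule eq)
  also have "\<dots> \<longleftrightarrow> ((\<lambda>y. (f y - f x) /\<^sub>R (y - x)) \<longlongrightarrow> D) (at x within S)"
    unfolding tendsto_norm_zero_iff LIM_zero_iff ..
  finally show ?thesis .
qed

lemma borel_measurable_lebesgue_continuous:
  fixes f :: "real \<Rightarrow> 'b::topological_space"
  assumes "continuous_on UNIV f"
  shows "f \<in> borel_measurable lebesgue"
  using borel_measurable_continuous_onI[OF assms] by (intro measurable_completion) simp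

lemma set_integrable_restrict_UNIV:
  fixes f :: "real \<Rightarrow> 'b::{banach, second_countable_topology}"
  assumes "integrable lebesgue f" "S \<in> sets lebesgue"
  shows "set_integrable lebesgue S f"
  unfolding set_integrable_def using integrable_mult_indicator[OF assms(2,1)] .

lemma set_integral_cong_off_point:
  fixes f :: "real \<Rightarrow> 'b::{banach, second_countable_topology}"
  assumes f: "integrable lebesgue f"
    and S: "S \<in> sets lebesgue" "T \<in> sets lebesgue" and ST: "\<And>t. t \<noteq> x \<Longrightarrow> t \<in> S \<longleftrightarrow> t \<in> T"
  shows "(LINT t:S|lebesgue. f t) = (LINT t:T|lebesgue. f t)"
  unfolding set_lebesgue_integral_def
proof (rule integral_cong_AE)
  have "AE t in lebesgue. t \<noteq> x" by (rule AE_I'[of "{x}"]) auto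
  then show "AE t in lebesgue. indicat_real S t *\<^sub>R f t = indicat_real T t *\<^sub>R f t"
    by eventually_elim (auto simp: indicator_def ST)
qed (use set_integrable_restrict_UNIV[OF f] S in
      \<open>simp_all add: set_integrable_def borel_measurable_integrable\<close>)

lemma tail_integral_split:
  fixes f :: "real \<Rightarrow> 'b::{banach, second_countable_topology}"
  assumes "integrable lebesgue f" "x \<le> y"
  shows "(LINT t:{x..}|lebesgue. f t) = (LINT t:{x..<y}|lebesgue. f t) + (LINT t:{y..}|lebesgue. f t)"
proof -
  have "{x..} = {x..<y} \<union> {y..}" using assms(2) by auto
  then show ?thesis
    using set_integral_Un[of "{x..<y}" "{y..}" lebesgue f] assms(1)
    by (simp add: set_integrable_restrict_UNIV disjoint_iff)
qed

lemma continuous_on_tail_integral: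
  fixes f :: "real \<Rightarrow> 'b::{banach, second_countable_topology}"
  assumes f: "integrable lebesgue f"
  shows "continuous_on UNIV (\<lambda>x. LINT t:{x..}|lebesgue. f t)"
proof (rule continuous_at_imp_continuous_on, rule ballI)
  fix x :: real
  have [measurable]: "f \<in> borel_measurable lebesgue" using f by auto
  show "isCont (\<lambda>x. LINT t:{x..}|lebesgue. f t) x"
    unfolding continuous_at_sequentially
  proof (intro allI impI)
    fix X :: "nat \<Rightarrow> real" assume X: "X \<longlonglongrightarrow> x"
    show "((\<lambda>x. LINT t:{x..}|lebesgue. f t) \<circ> X) \<longlonglongrightarrow> (LINT t:{x..}|lebesgue. f t)"
      unfolding o_def set_lebesgue_integral_def
    proof (rule integral_dominated_convergence[where w="\<lambda>t. norm (f t)"])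
      show "(\<lambda>t. indicat_real {x..} t *\<^sub>R f t) \<in> borel_measurable lebesgue"
        "\<And>i. (\<lambda>t. indicat_real {X i..} t *\<^sub>R f t) \<in> borel_measurable lebesgue"
        by (intro borel_measurable_scaleR borel_measurable_indicator; simp)+
      show "integrable lebesgue (\<lambda>t. norm (f t))" using f by simp
      have "AE t in lebesgue. t \<noteq> x"
        by (rule AE_I'[of "{x}"]) auto
      then show "AE t in lebesgue. (\<lambda>i. indicat_real {X i..} t *\<^sub>R f t) \<longlonglongrightarrow> indicat_real {x..} t *\<^sub>R f t"
      proof eventually_elim
        case (elim t)
        have "\<forall>\<^sub>F i in sequentially. indicat_real {X i..} t = indicat_real {x..} t"
        proof (cases "t < x")
          case True
          show ?thesis using order_tendstoD(1)[OF X True] by eventually_elim (use True in \<open>auto simp: indicator_def\<close>)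
        next
          case False
          then have "x < t" using elim by auto
          show ?thesis using order_tendstoD(2)[OF X \<open>x < t\<close>] by eventually_elim (use \<open>x < t\<close> in \<open>auto simp: indicator_def\<close>)
        qed
        then show ?case
          by (intro tendsto_eventually) (erule eventually_mono, simp)
      qed
      show "\<And>i. AE t in lebesgue. norm (indicat_real {X i..} t *\<^sub>R f t) \<le> norm (f t)"
        by (auto simp: indicator_def)
    qed
  qed
qed

lemma tail_integral_tendsto_0:
  fixes f :: "real \<Rightarrow> 'b::{banach, second_countable_topology}"
  assumes f: "integrable lebesgue f"
  shows "((\<lambda>x. LINT t:{x..}|lebesgue. f t) \<longlongrightarrow> 0) at_top"
proof -
  have [measurable]: "f \<in> borel_measurable lebesgue" using f by auto
  have "((\<lambda>x. LINT t|lebesgue. indicat_real {x..} t *\<^sub>R f t) \<longlongrightarrow> (LINT t|(lebesgue::real measure). (0::'b))) at_top"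
  proof (rule integral_dominated_convergence_at_top[where w="\<lambda>t. norm (f t)"])
    show "\<And>i. (\<lambda>t. indicat_real {i..} t *\<^sub>R f t) \<in> borel_measurable lebesgue"
        by (intro borel_measurable_scaleR borel_measurable_indicator; simp)+
    show "integrable lebesgue (\<lambda>t. norm (f t))" using f by simp
    show "AE t in lebesgue. ((\<lambda>i. indicat_real {i..} t *\<^sub>R f t) \<longlongrightarrow> 0) at_top"
    proof (rule AE_I2)
      fix t :: real
      show "((\<lambda>i. indicat_real {i..} t *\<^sub>R f t) \<longlongrightarrow> 0) at_top"
        by (rule tendsto_eventually)
           (use eventually_gt_at_top[of t] in eventually_elim, auto simp: indicator_def)
    qed
  qed (auto simp: indicator_def)
  then show ?thesis by (simp add: set_lebesgue_integral_def)
qed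

lemma set_integral_mono_norm:
  fixes f :: "real \<Rightarrow> 'b::{banach, second_countable_topology}"
  assumes "set_integrable lebesgue S g" "\<And>t. t \<in> S \<Longrightarrow> norm (f t) \<le> g t"
  shows "norm (LINT t:S|lebesgue. f t) \<le> (LINT t:S|lebesgue. g t)"
proof (cases "set_integrable lebesgue S f")
  case True
  then show ?thesis
    using assms unfolding set_lebesgue_integral_def set_integrable_def
    by (intro Bochner_Integration.integral_norm_bound_integral) (auto simp: indicator_def)
next
  case False
  then have "(LINT t:S|lebesgue. f t) = 0"
    unfolding set_lebesgue_integral_def set_integrable_def by (rule not_integrable_integral_eq)
  moreover have "0 \<le> (LINT t:S|lebesgue. g t)"
    unfolding set_lebesgue_integral_def
  proof (intro integral_nonneg_AE AE_I2)
    fix t show "0 \<le> indicat_real S t *\<^sub>R g t"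
      using order_trans[OF norm_ge_zero assms(2), of t] by (auto simp: indicator_def)
  qed
  ultimately show ?thesis by simp
qed

text \<open>Split \<open>H \<le> N + max 0 (H - N)\<close>. The first part contributes \<open>N\<close> times the total length, and
  the second at most its integral over the whole line, which is small for large \<open>N\<close> by dominated
  convergence.\<close>

lemma abs_continuous_on_interval_if_integral_bound:
  assumes H: "integrable lebesgue H" "\<And>t. 0 \<le> H t"
    and F: "\<And>u v. b \<le> u \<Longrightarrow> u \<le> v \<Longrightarrow> v \<le> c \<Longrightarrow> norm (F v - F u) \<le> (LINT t:{u..<v}|lebesgue. H t)"
  shows "abs_continuous_on_interval b c F"
  unfolding abs_continuous_on_interval_def
proof (intro allI impI)
  fix \<epsilon> :: real assume "\<epsilon> > 0"
  have [measurable]: "H \<in> borel_measurable lebesgue" using H by auto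
  define R where "R = (\<lambda>N t. max 0 (H t - real N))"
  have Rint: "integrable lebesgue (R N)" for N
    by (rule Bochner_Integration.integrable_bound[OF H(1)])
       (auto simp: R_def H)
  have "(\<lambda>N. LINT t|lebesgue. R N t) \<longlonglongrightarrow> (LINT t|(lebesgue::real measure). (0::real))"
  proof (rule integral_dominated_convergence[where w=H])
    show "AE t in lebesgue. (\<lambda>N. R N t) \<longlonglongrightarrow> 0"
    proof (rule AE_I2)
      fix t
      obtain N0 where "H t \<le> real N0" using real_arch_simple by blast
      then have "\<forall>\<^sub>F N in sequentially. R N t = 0"
        unfolding R_def eventually_sequentially by (intro exI[of _ N0]) auto
      then show "(\<lambda>N. R N t) \<longlonglongrightarrow> 0" by (rule tendsto_eventually)
    qed
  qed (use H Rint in \<open>auto simp: R_def\<close>)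
  then have "\<forall>\<^sub>F N in sequentially. (LINT t|lebesgue. R N t) < \<epsilon> / 2"
    using \<open>\<epsilon> > 0\<close> by (intro order_tendstoD(2)) auto
  then obtain N where N: "(LINT t|lebesgue. R N t) < \<epsilon> / 2"
    by (auto simp: eventually_sequentially)
  show "\<exists>\<delta>>0. \<forall>(n::nat) u v.
        (\<forall>i<n. b \<le> u i \<and> u i \<le> v i \<and> v i \<le> c) \<longrightarrow>
        disjoint_family_on (\<lambda>i. {u i<..<v i}) {..<n} \<longrightarrow>
        (\<Sum>i<n. v i - u i) < \<delta> \<longrightarrow>
        (\<Sum>i<n. norm (F (v i) - F (u i))) < \<epsilon>"
  proof (intro exI[of _ "\<epsilon> / (2 * (real N + 1))"] conjI allI impI)
    show "0 < \<epsilon> / (2 * (real N + 1))" using \<open>\<epsilon> > 0\<close> by simp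
    fix n :: nat and u v :: "nat \<Rightarrow> real"
    assume uv: "\<forall>i<n. b \<le> u i \<and> u i \<le> v i \<and> v i \<le> c"
      and disj: "disjoint_family_on (\<lambda>i. {u i<..<v i}) {..<n}"
      and len: "(\<Sum>i<n. v i - u i) < \<epsilon> / (2 * (real N + 1))"
    have RI: "set_integrable lebesgue S (R N)" if "S \<in> sets lebesgue" for S
      using set_integrable_restrict_UNIV[OF Rint that] .
    have "norm (F (v i) - F (u i)) \<le> real N * (v i - u i) + (LINT t:{u i<..<v i}|lebesgue. R N t)"
      if "i < n" for i
    proof -
      have le: "u i \<le> v i" using uv that by auto
      have fin: "set_integrable lebesgue {u i..<v i} (\<lambda>t. real N)"
        unfolding set_integrable_def
        by (intro integrable_scaleR_left integrable_real_indicator) (use le in auto)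
      have "norm (F (v i) - F (u i)) \<le> (LINT t:{u i..<v i}|lebesgue. H t)"
        using F uv that by blast
      also have "\<dots> \<le> (LINT t:{u i..<v i}|lebesgue. real N + R N t)"
        by (rule set_integral_mono)
           (auto simp: R_def intro!: set_integrable_restrict_UNIV[OF H(1)] set_integral_add fin RI[unfolded R_def])
      also have "\<dots> = (LINT t:{u i..<v i}|lebesgue. real N) + (LINT t:{u i..<v i}|lebesgue. R N t)"
        by (intro set_integral_add fin RI) simp
      also have "(LINT t:{u i..<v i}|lebesgue. real N) = real N * (v i - u i)"
        using le by (simp add: set_lebesgue_integral_def)
      also have "(LINT t:{u i..<v i}|lebesgue. R N t) = (LINT t:{u i<..<v i}|lebesgue. R N t)"
        by (rule set_integral_cong_off_point[OF Rint, of _ _ "u i"]) auto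
      finally show ?thesis .
    qed
    then have "(\<Sum>i<n. norm (F (v i) - F (u i)))
        \<le> (\<Sum>i<n. real N * (v i - u i) + (LINT t:{u i<..<v i}|lebesgue. R N t))"
      by (intro sum_mono) auto
    also have "\<dots> = real N * (\<Sum>i<n. v i - u i) + (\<Sum>i<n. LINT t:{u i<..<v i}|lebesgue. R N t)"
      by (simp add: sum.distrib sum_distrib_left)
    also have "(\<Sum>i<n. LINT t:{u i<..<v i}|lebesgue. R N t) = (LINT t:(\<Union>i<n. {u i<..<v i})|lebesgue. R N t)"
      by (subst set_integral_finite_Union) (use disj RI in \<open>auto simp: disjoint_family_on_def\<close>)
    also have "\<dots> \<le> (LINT t|lebesgue. R N t)"
      unfolding set_lebesgue_integral_def
      by (intro integral_mono Rint integrable_mult_indicator)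
         (auto simp: indicator_def R_def)
    also have "real N * (\<Sum>i<n. v i - u i) \<le> (real N + 1) * (\<Sum>i<n. v i - u i)"
      using uv by (intro mult_right_mono sum_nonneg) auto
    also have "\<dots> \<le> (real N + 1) * (\<epsilon> / (2 * (real N + 1)))"
      using len by (intro mult_left_mono) auto
    also have "\<dots> = \<epsilon> / 2" using of_nat_0_le_iff[of N, where 'a=real] by (simp add: divide_simps)
    finally show "(\<Sum>i<n. norm (F (v i) - F (u i))) < \<epsilon>" using N by linarith
  qed
qed

lemma integral_Icc_eq_tail_diff:
  fixes f :: "real \<Rightarrow> 'b::euclidean_space"
  assumes f: "integrable lebesgue f" and "x \<le> y"
  shows "integral {x..y} f = (LINT t:{x..}|lebesgue. f t) - (LINT t:{y..}|lebesgue. f t)"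
proof -
  have "(LINT t:{x..<y}|lebesgue. f t) = integral {x..<y} f"
    by (rule set_lebesgue_integral_eq_integral) (rule set_integrable_restrict_UNIV[OF f], simp)
  also have "\<dots> = integral {x..y} f"
    by (rule integral_subset_negligible) 
       (auto intro!: negligible_subset[OF negligible_sing[of y]])
  finally show ?thesis using tail_integral_split[OF assms] by simp
qed

text \<open>The right half of Lebesgue's differentiation theorem is \<open>integrable_ccontinuous_explicit\<close>,
  whose cubes in dimension one are the intervals \<open>[x, x + h]\<close>.\<close>

lemma AE_tail_integral_right_derivative:
  fixes f :: "real \<Rightarrow> 'b::euclidean_space"
  assumes f: "integrable lebesgue f"
  shows "AE x in lebesgue. ((\<lambda>x. LINT t:{x..}|lebesgue. f t) has_vector_derivative - f x) (at_right x)"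
proof -
  have "f integrable_on cbox a b" for a b
    using set_integrable_restrict_UNIV[OF f, of "{a..b}"]
    by (auto intro: set_lebesgue_integral_eq_integral(1))
  from integrable_ccontinuous_explicit[OF this] obtain N where N: "negligible N"
    "\<And>x e. \<lbrakk>x \<notin> N; 0 < e\<rbrakk> \<Longrightarrow> \<exists>d>0. \<forall>h. 0 < h \<and> h < d \<longrightarrow>
                  norm (integral (cbox x (x + h *\<^sub>R One)) f /\<^sub>R h ^ DIM(real) - f x) < e"
    by blast
  let ?T = "\<lambda>x. LINT t:{x..}|lebesgue. f t"
  have "(?T has_vector_derivative - f x) (at_right x)" if xN: "x \<notin> N" for x
    unfolding has_vector_derivative_iff_quotient tendsto_iff
  proof (intro allI impI)
    fix e :: real assume "e > 0"
    then obtain d where d: "d > 0" "\<And>h. 0 < h \<Longrightarrow> h < d \<Longrightarrow>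
        norm (integral (cbox x (x + h)) f /\<^sub>R h - f x) < e"
      using N(2)[OF xN, of e] by (auto simp: field_simps)
    show "\<forall>\<^sub>F y in at_right x. dist ((?T y - ?T x) /\<^sub>R (y - x)) (- f x) < e"
      unfolding eventually_at_right_field
    proof (intro exI[of _ "x + d"] conjI allI impI)
      fix y assume y: "x < y" "y < x + d"
      have "norm (integral (cbox x y) f /\<^sub>R (y - x) - f x) < e"
        using d(2)[of "y - x"] y by simp
      moreover have "(?T y - ?T x) /\<^sub>R (y - x) - - f x = - (integral (cbox x y) f /\<^sub>R (y - x) - f x)"
        using integral_Icc_eq_tail_diff[OF f, of x y] y by (simp add: scaleR_diff_right)
      ultimately show "dist ((?T y - ?T x) /\<^sub>R (y - x)) (- f x) < e"
        unfolding dist_norm by (simp only: norm_minus_cancel)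
    qed (use d in auto)
  qed
  with N(1) show ?thesis
    by (intro AE_I'[of N]) (auto simp: negligible_iff_null_sets)
qed

text \<open>The left derivative is the right derivative for the reflected function \<open>\<lambda>t. f (- t)\<close>, since
  Lebesgue measure is invariant under \<open>t \<mapsto> - t\<close>.\<close>

lemma AE_tail_integral_derivative:
  fixes f :: "real \<Rightarrow> 'b::euclidean_space"
  assumes f: "integrable lebesgue f"
  shows "AE x in lebesgue. ((\<lambda>x. LINT t:{x..}|lebesgue. f t) has_vector_derivative - f x) (at x)"
proof -
  let ?T = "\<lambda>x. LINT t:{x..}|lebesgue. f t"
  let ?R = "\<lambda>x. LINT t:{x..}|lebesgue. f (- t)"
  have lin: "(lebesgue :: real measure) = density (distr lebesgue lebesgue uminus) (\<lambda>x. 1)"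
    using lebesgue_real_affine[of "-1" 0] by simp
  have mu: "(uminus :: real \<Rightarrow> real) \<in> lebesgue \<rightarrow>\<^sub>M lebesgue"
  proof -
    have "(*\<^sub>R) (-1) = (uminus :: real \<Rightarrow> real)" by (simp add: fun_eq_iff)
    then show ?thesis using lebesgue_measurable_scaling[of "-1", where 'a=real] by simp
  qed
  have di: "distr lebesgue lebesgue (uminus :: real \<Rightarrow> real) = lebesgue"
    using lin by (simp add: density_1)
  have f': "integrable lebesgue (\<lambda>t. f (- t))"
    using has_bochner_integral_lebesgue_real_affine_iff[of "-1" f _ 0] f
    by (auto simp: has_bochner_integral_iff)
  have reflect: "?T x = integral\<^sup>L lebesgue f - ?R (- x)" for x
  proof -
    have "?R (- x) = (LINT t:{..x}|lebesgue. f t)"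
    proof -
      have "(\<lambda>t. indicat_real {..x} t *\<^sub>R f t) \<in> borel_measurable lebesgue"
        using set_integrable_restrict_UNIV[OF f, of "{..x}"]
        by (simp add: set_integrable_def borel_measurable_integrable)
      from integral_distr[OF mu this]
      have "(LINT t:{..x}|lebesgue. f t) = (LINT t|lebesgue. indicat_real {..x} (- t) *\<^sub>R f (- t))"
        by (simp add: di set_lebesgue_integral_def)
      moreover have "indicat_real {..x} (- t) = indicat_real {- x..} t" for t
        by (auto simp: indicator_def)
      ultimately show ?thesis by (simp add: set_lebesgue_integral_def)
    qed
    moreover have "(LINT t:{..x}|lebesgue. f t) = (LINT t:{..<x}|lebesgue. f t)"
      by (rule set_integral_cong_off_point[OF f, of _ _ x]) auto
    moreover have "integral\<^sup>L lebesgue f = (LINT t:{..<x} \<union> {x..}|lebesgue. f t)"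
    proof -
      have "{..<x} \<union> {x..} = UNIV" by auto
      then show ?thesis by (simp add: set_lebesgue_integral_def)
    qed
    moreover have "\<dots> = (LINT t:{..<x}|lebesgue. f t) + ?T x"
      by (rule set_integral_Un) (auto intro!: set_integrable_restrict_UNIV f)
    ultimately show ?thesis by simp
  qed
  have "AE x in lebesgue. (?R has_vector_derivative - f (- (- x))) (at_right (- x))"
  proof -
    have "AE x in distr lebesgue lebesgue uminus. (?R has_vector_derivative - f (- x)) (at_right x)"
      unfolding di by (rule AE_tail_integral_right_derivative[OF f'])
    from AE_distrD[OF mu this] show ?thesis by simp
  qed
  moreover note AE_tail_integral_right_derivative[OF f]
  ultimately show ?thesis
  proof eventually_elim
    case (elim x)
    have "((?R \<circ> uminus) has_vector_derivative (-1) *\<^sub>R - f x) (at_left x)"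
    proof (rule vector_diff_chain_within)
      show "(uminus has_vector_derivative -1) (at_left x)"
        by (auto intro!: derivative_eq_intros)
      have "uminus ` {..<x} = {- x<..}" by simp
      then show "(?R has_vector_derivative - f x) (at (- x) within uminus ` {..<x})"
        using elim(1) by simp
    qed
    then have "((\<lambda>x. integral\<^sup>L lebesgue f - (?R \<circ> uminus) x) has_vector_derivative (0 - (-1) *\<^sub>R - f x)) (at_left x)"
      by (intro has_vector_derivative_diff has_vector_derivative_const)
    then have "(?T has_vector_derivative - f x) (at_left x)"
      unfolding reflect by (simp add: o_def)
    then have "((\<lambda>y. (?T y - ?T x) /\<^sub>R (y - x)) \<longlongrightarrow> - f x) (at x)"
      using elim(2) unfolding has_vector_derivative_iff_quotient by (rule filterlim_split_at)
    then show ?case unfolding has_vector_derivative_iff_quotient .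
  qed
qed

lemma tail_integral_antimono:
  fixes h :: "real \<Rightarrow> real"
  assumes h: "integrable lebesgue h" "\<And>t. 0 \<le> h t" and "x \<le> y"
  shows "(LINT t:{y..}|lebesgue. h t) \<le> (LINT t:{x..}|lebesgue. h t)"
proof -
  have "0 \<le> (LINT t:{x..<y}|lebesgue. h t)"
    unfolding set_lebesgue_integral_def using h(2) by (intro integral_nonneg_AE AE_I2) (simp add: indicator_def)
  then show ?thesis using tail_integral_split[OF h(1) \<open>x \<le> y\<close>] by simp
qed

lemma tail_integral_nonneg:
  fixes h :: "real \<Rightarrow> real"
  assumes "\<And>t. 0 \<le> h t"
  shows "0 \<le> (LINT t:{x..}|lebesgue. h t)"
  unfolding set_lebesgue_integral_def using assms by (intro integral_nonneg_AE AE_I2) (simp add: indicator_def)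

text \<open>Formally \<open>h = - M'\<close>, so the integral equals \<open>(exp (\<kappa> M(x)) - 1) / \<kappa>\<close>. The factor \<open>2\<close> buys a
  proof without a change of variables: cut the half line at points where \<open>\<kappa> M\<close> is an integer. On
  a piece along which \<open>\<kappa> M\<close> drops by \<open>u \<le> 1\<close> the integrand is bounded by its weight at the left end, and
  \<open>u + 2 exp (- u) \<le> 2\<close> lets the pieces be added by induction on their number.\<close>

lemma tail_integral_exp_weight:
  fixes h :: "real \<Rightarrow> real"
  assumes h: "integrable lebesgue h" "\<And>t. 0 \<le> h t" and "\<kappa> > 0"
  defines "M \<equiv> \<lambda>x. LINT t:{x..}|lebesgue. h t"
  shows "integrable lebesgue (\<lambda>t. h t * exp (\<kappa> * M t))"
    and "(LINT t:{x..}|lebesgue. h t * exp (\<kappa> * M t)) \<le> 2 / \<kappa> * exp (\<kappa> * M x)"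
proof -
  have [measurable]: "h \<in> borel_measurable lebesgue" using h by auto
  have M_cont: "continuous_on UNIV M" unfolding M_def by (rule continuous_on_tail_integral[OF h(1)])
  have M_meas [measurable]: "M \<in> borel_measurable lebesgue"
    by (rule borel_measurable_lebesgue_continuous[OF M_cont])
  have M_mono: "M y \<le> M x" if "x \<le> y" for x y
    unfolding M_def by (rule tail_integral_antimono[OF h that])
  have M0: "0 \<le> M x" for x unfolding M_def by (rule tail_integral_nonneg[OF h(2)])
  have M_le: "M x \<le> integral\<^sup>L lebesgue h" for x
    unfolding M_def set_lebesgue_integral_def
    by (intro integral_mono integrable_mult_indicator h) (auto simp: indicator_def h)
  show J: "integrable lebesgue (\<lambda>t. h t * exp (\<kappa> * M t))"
  proof (rule Bochner_Integration.integrable_bound)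
    show "integrable lebesgue (\<lambda>t. h t * exp (\<kappa> * integral\<^sup>L lebesgue h))" using h by simp
    show "AE t in lebesgue. norm (h t * exp (\<kappa> * M t)) \<le> norm (h t * exp (\<kappa> * integral\<^sup>L lebesgue h))"
      using \<open>\<kappa> > 0\<close> h(2) M_le by (auto intro!: mult_left_mono simp: abs_mult)
  qed measurable
  let ?J = "\<lambda>x. LINT t:{x..}|lebesgue. h t * exp (\<kappa> * M t)"
  have piece: "(LINT t:S|lebesgue. h t * exp (\<kappa> * M t)) \<le> exp (\<kappa> * M x) * (LINT t:S|lebesgue. h t)"
    if "S \<in> sets lebesgue" "S \<subseteq> {x..}" for S x
  proof -
    have "(LINT t:S|lebesgue. h t * exp (\<kappa> * M t)) \<le> (LINT t:S|lebesgue. exp (\<kappa> * M x) * h t)"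
    proof (rule set_integral_mono)
      fix t assume "t \<in> S"
      then have "exp (\<kappa> * M t) \<le> exp (\<kappa> * M x)"
        using that M_mono[of x t] \<open>\<kappa> > 0\<close> by auto
      then show "h t * exp (\<kappa> * M t) \<le> exp (\<kappa> * M x) * h t"
        using h(2)[of t] by (simp add: mult.commute mult_left_mono)
    qed (use that J h in \<open>auto intro!: set_integrable_restrict_UNIV\<close>)
    then show ?thesis by simp
  qed
  have "\<kappa> * M x \<le> real (Suc n) \<Longrightarrow> ?J x \<le> 2 / \<kappa> * exp (\<kappa> * M x)" for n x
  proof (induction n arbitrary: x)
    case 0
    have "?J x \<le> exp (\<kappa> * M x) * M x" using piece[of "{x..}" x] by (simp add: M_def)
    also have "\<dots> \<le> exp (\<kappa> * M x) * (2 / \<kappa>)"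
      using 0 \<open>\<kappa> > 0\<close> by (intro mult_left_mono) (auto simp: field_simps)
    finally show ?case by (simp add: mult.commute)
  next
    case (Suc n)
    show ?case
    proof (cases "\<kappa> * M x \<le> real (Suc n)")
      case True
      then show ?thesis by (rule Suc.IH)
    next
      case False
      have "((\<lambda>x. \<kappa> * M x) \<longlongrightarrow> \<kappa> * 0) at_top"
        unfolding M_def by (intro tendsto_intros tail_integral_tendsto_0 h)
      then have "\<forall>\<^sub>F y in at_top. \<kappa> * M y < real (Suc n)"
        by (intro order_tendstoD(2)) auto
      then obtain z where z: "\<And>y. y \<ge> z \<Longrightarrow> \<kappa> * M y < real (Suc n)"
        by (auto simp: eventually_at_top_linorder)
      have "\<exists>y\<ge>x. y \<le> max x z \<and> \<kappa> * M y = real (Suc n)"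
        by (rule IVT2') (use z[of "max x z"] False in \<open>auto intro!: continuous_intros continuous_on_subset[OF M_cont]\<close>)
      then obtain y where y: "x \<le> y" "\<kappa> * M y = real (Suc n)" by blast
      define u where "u = \<kappa> * M x - \<kappa> * M y"
      have u: "0 \<le> u" "u \<le> 1" using y Suc.prems mult_left_mono[OF M_mono[OF y(1)], of \<kappa>] \<open>\<kappa> > 0\<close> by (auto simp: u_def)
      have "M x - M y = u / \<kappa>" using \<open>\<kappa> > 0\<close> by (simp add: u_def field_simps)
      have "exp (- u) \<le> 1 / (1 + u)"
        using exp_ge_add_one_self[of u] u by (simp add: exp_minus divide_simps)
      then have "u + 2 * exp (- u) \<le> u + 2 * (1 / (1 + u))" by simp
      also have "\<dots> \<le> 2"
      proof -
        have "u * u \<le> u" using u by (simp add: mult_left_le)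
        then show ?thesis using u by (simp add: field_simps)
      qed
      finally have key: "u + 2 * exp (- u) \<le> 2" .
      have "?J x = (LINT t:{x..<y}|lebesgue. h t * exp (\<kappa> * M t)) + ?J y"
        by (rule tail_integral_split[OF J y(1)])
      also have "\<dots> \<le> exp (\<kappa> * M x) * (u / \<kappa>) + 2 / \<kappa> * exp (\<kappa> * M y)"
      proof (rule add_mono)
        show "?J y \<le> 2 / \<kappa> * exp (\<kappa> * M y)" using y by (intro Suc.IH) simp
        have "(LINT t:{x..<y}|lebesgue. h t) = u / \<kappa>"
          using tail_integral_split[OF h(1) y(1)] \<open>M x - M y = u / \<kappa>\<close> by (simp add: M_def)
        then show "(LINT t:{x..<y}|lebesgue. h t * exp (\<kappa> * M t)) \<le> exp (\<kappa> * M x) * (u / \<kappa>)"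
          using piece[of "{x..<y}" x] by (simp add: atLeastLessThan_def)
      qed
      also have "exp (\<kappa> * M y) = exp (\<kappa> * M x) * exp (- u)"
        by (simp add: u_def exp_add[symmetric])
      also have "exp (\<kappa> * M x) * (u / \<kappa>) + 2 / \<kappa> * (exp (\<kappa> * M x) * exp (- u))
          = exp (\<kappa> * M x) / \<kappa> * (u + 2 * exp (- u))"
        by (simp add: algebra_simps add_divide_distrib)
      also have "\<dots> \<le> exp (\<kappa> * M x) / \<kappa> * 2"
        using key \<open>\<kappa> > 0\<close> by (intro mult_left_mono) auto
      finally show ?thesis by (simp add: mult.commute)
    qed
  qed
  moreover obtain n where "\<kappa> * M x \<le> real n" using real_arch_simple by blast
  then have "\<kappa> * M x \<le> real (Suc n)" by simp
  ultimately show "?J x \<le> 2 / \<kappa> * exp (\<kappa> * M x)" by blast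
qed

section \<open>Holomorphic dependence on a parameter\<close>

text \<open>Cauchy's inequality on discs of a fixed radius \<open>r\<close> turns the bound \<open>G\<close> on the integrand into the
  Lipschitz bound \<open>G / r\<close> for its dependence on the parameter. This dominates the difference
  quotients, so they may be passed to the limit under the integral sign.\<close>

lemma holomorphic_on_integral:
  fixes F :: "complex \<Rightarrow> 'a \<Rightarrow> complex"
  assumes \<Omega>: "open \<Omega>"
    and meas: "\<And>l. l \<in> \<Omega> \<Longrightarrow> F l \<in> borel_measurable M"
    and hol: "\<And>t. t \<in> space M \<Longrightarrow> (\<lambda>l. F l t) holomorphic_on \<Omega>"
    and bound: "\<And>l t. l \<in> \<Omega> \<Longrightarrow> t \<in> space M \<Longrightarrow> norm (F l t) \<le> G t"
    and G: "integrable M G"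
  shows "(\<lambda>l. LINT t|M. F l t) holomorphic_on \<Omega>"
proof -
  have "(\<lambda>l. LINT t|M. F l t) field_differentiable (at l0)" if l0: "l0 \<in> \<Omega>" for l0
  proof -
    obtain r0 where r0: "r0 > 0" "cball l0 r0 \<subseteq> \<Omega>" using \<Omega> l0 open_contains_cball by blast
    define r where "r = r0 / 2"
    have r: "r > 0" using r0 by (simp add: r_def)
    have sub: "cball l r \<subseteq> \<Omega>" if "l \<in> ball l0 r" for l
    proof
      fix z assume "z \<in> cball l r"
      then have "dist l0 z \<le> r0" using that dist_triangle[of l0 z l] by (simp add: r_def)
      then show "z \<in> \<Omega>" using r0 by auto
    qed
    have l\<Omega>: "l \<in> \<Omega>" if "l \<in> ball l0 r" for l using sub[OF that] r by auto
    have lip: "norm (F l t - F l0 t) \<le> G t / r * norm (l - l0)"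
      if t: "t \<in> space M" and l: "l \<in> ball l0 r" for t l
    proof (rule field_differentiable_bound[of "ball l0 r"])
      fix z assume z: "z \<in> ball l0 r"
      have hz: "(\<lambda>l. F l t) holomorphic_on \<Omega>" by (rule hol[OF t])
      show "((\<lambda>l. F l t) has_field_derivative deriv (\<lambda>l. F l t) z) (at z within ball l0 r)"
        using holomorphic_derivI[OF hz \<Omega> l\<Omega>[OF z]] by (rule has_field_derivative_at_within)
      have "norm ((deriv ^^ 1) (\<lambda>l. F l t) z) \<le> fact 1 * G t / r ^ 1"
      proof (rule Cauchy_inequality)
        show "(\<lambda>l. F l t) holomorphic_on ball z r"
          using hz sub[OF z] by (meson ball_subset_cball holomorphic_on_subset order_trans)
        show "continuous_on (cball z r) (\<lambda>l. F l t)"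
          using hz sub[OF z] by (meson holomorphic_on_imp_continuous_on holomorphic_on_subset)
        show "norm (F x t) \<le> G t" if "norm (z - x) = r" for x
          using that sub[OF z] by (intro bound t) (auto simp: dist_norm)
      qed (rule r)
      then show "norm (deriv (\<lambda>l. F l t) z) \<le> G t / r" by simp
    qed (use r l in auto)
    define D where "D = (\<lambda>t. deriv (\<lambda>l. F l t) l0)"
    have quot: "((\<lambda>l. (F l t - F l0 t) / (l - l0)) \<longlongrightarrow> D t) (at l0)" if "t \<in> space M" for t
      using holomorphic_derivI[OF hol[OF that] \<Omega> l0] by (simp add: D_def has_field_derivative_iff)
    have int: "integrable M (F l)" if "l \<in> \<Omega>" for l
      using that bound by (intro Bochner_Integration.integrable_bound[OF G] meas AE_I2)
        (auto intro: order_trans[OF _ abs_ge_self])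
    have "((\<lambda>l. LINT t|M. F l t) has_field_derivative (LINT t|M. D t)) (at l0 within ball l0 r)"
      unfolding has_field_derivative_iff tendsto_at_iff_sequentially
    proof (intro allI impI)
      fix X :: "nat \<Rightarrow> complex"
      assume X: "\<forall>i. X i \<in> ball l0 r - {l0}" and lim: "X \<longlonglongrightarrow> l0"
      have XO: "X i \<in> \<Omega>" for i using X l\<Omega> by blast
      have [measurable]: "F (X i) \<in> borel_measurable M" "F l0 \<in> borel_measurable M" for i
        using meas XO l0 by auto
      have conv: "(\<lambda>i. (F (X i) t - F l0 t) / (X i - l0)) \<longlonglongrightarrow> D t" if "t \<in> space M" for t
        using quot[OF that] X lim unfolding tendsto_at_iff_sequentially o_def by blast
      have "(\<lambda>i. LINT t|M. (F (X i) t - F l0 t) / (X i - l0)) \<longlonglongrightarrow> (LINT t|M. D t)"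
      proof (rule integral_dominated_convergence[where w="\<lambda>t. G t / r"])
        show "D \<in> borel_measurable M"
          by (rule borel_measurable_LIMSEQ_metric[OF _ conv]) measurable
        show "AE t in M. norm ((F (X i) t - F l0 t) / (X i - l0)) \<le> G t / r" for i
          using lip[of _ "X i"] X by (intro AE_I2) (auto simp: norm_divide divide_le_eq)
      qed (use conv G in auto)
      also have "(\<lambda>i. LINT t|M. (F (X i) t - F l0 t) / (X i - l0))
          = (\<lambda>l. ((LINT t|M. F l t) - (LINT t|M. F l0 t)) / (l - l0)) \<circ> X"
        using int XO l0 by (auto simp: fun_eq_iff)
      finally show "\<dots> \<longlonglongrightarrow> (LINT t|M. D t)" .
    qed
    then show ?thesis
      using r at_within_open[of l0 "ball l0 r"] by (auto simp: field_differentiable_def)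
  qed
  then show ?thesis
    unfolding holomorphic_on_def using field_differentiable_at_within by blast
qed

section \<open>Volterra equations on half lines\<close>

fun picard :: "(real \<Rightarrow> real \<Rightarrow> complex) \<Rightarrow> (real \<Rightarrow> complex) \<Rightarrow> nat \<Rightarrow> real \<Rightarrow> complex" where
  "picard K g 0 x = 0"
| "picard K g (Suc n) x = g x - (LINT t:{x..}|lebesgue. K x t * picard K g n t)"

text \<open>The weights that govern convergence do not enter the definition, so solutions obtained
  on different parameter domains agree.\<close>

definition volterra_solution :: "(real \<Rightarrow> real \<Rightarrow> complex) \<Rightarrow> (real \<Rightarrow> complex) \<Rightarrow> real \<Rightarrow> complex" where
  "volterra_solution K g x = lim (\<lambda>n. picard K g n x)"

text \<open>The assumption \<open>K_bound\<close> says that, after conjugation with the weight \<open>\<rho>\<close>, the kernel is dominated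
  by an integrable function of \<open>t\<close> alone. The last assumption is satisfied by sums of products
  of a function of \<open>x\<close> and a function of \<open>t\<close>.\<close>

locale weighted_volterra =
  fixes K :: "real \<Rightarrow> real \<Rightarrow> complex" and g :: "real \<Rightarrow> complex"
    and \<rho> h :: "real \<Rightarrow> real" and A :: real
  assumes rho_nonneg: "0 \<le> \<rho> x"
    and h_nonneg: "0 \<le> h t"
    and h_integrable: "integrable lebesgue h"
    and A_nonneg: "0 \<le> A"
    and K_bound: "x \<le> t \<Longrightarrow> norm (K x t) * \<rho> t \<le> \<rho> x * h t"
    and K_measurable: "K x \<in> borel_measurable lebesgue"
    and g_bound: "norm (g x) \<le> A * \<rho> x"
    and g_measurable: "g \<in> borel_measurable lebesgue"
    and operator_measurable: "\<And>f B. f \<in> borel_measurable lebesgue \<Longrightarrow> (\<And>t. norm (f t) \<le> B * \<rho> t) \<Longrightarrow>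
      (\<lambda>x. LINT t:{x..}|lebesgue. K x t * f t) \<in> borel_measurable lebesgue"
begin

text \<open>The exponent \<open>4\<close> makes the constant \<open>2 / \<kappa>\<close> of \<open>tail_integral_exp_weight\<close> equal to \<open>1 / 2\<close>.\<close>

definition \<phi> :: "real \<Rightarrow> real" where
  "\<phi> x = exp (4 * (LINT t:{x..}|lebesgue. h t))"

definition \<phi>_max :: real where
  "\<phi>_max = exp (4 * integral\<^sup>L lebesgue h)"

lemma phi_ge_1: "1 \<le> \<phi> x"
  unfolding \<phi>_def using tail_integral_nonneg[of h] h_nonneg by simp

lemma phi_le_max: "\<phi> x \<le> \<phi>_max"
proof -
  have "(LINT t:{x..}|lebesgue. h t) \<le> integral\<^sup>L lebesgue h"
    unfolding set_lebesgue_integral_def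
    by (intro integral_mono integrable_mult_indicator h_integrable) (auto simp: indicator_def h_nonneg)
  then show ?thesis by (simp add: \<phi>_def \<phi>_max_def)
qed

lemma phi_max_ge_1: "1 \<le> \<phi>_max"
  using phi_ge_1 phi_le_max order_trans by blast

lemma phi_weighted_le:
  assumes "0 \<le> B" "norm y \<le> B * \<rho> t * \<phi> t"
  shows "norm y \<le> (B * \<phi>_max) * \<rho> t"
proof -
  have "B * \<rho> t * \<phi> t \<le> B * \<rho> t * \<phi>_max"
    using assms rho_nonneg phi_le_max by (intro mult_left_mono) auto
  then show ?thesis using assms by (simp add: mult_ac)
qed

lemma g_bound_phi: "norm (g x) \<le> A * \<rho> x * \<phi> x"
proof -
  have "A * \<rho> x * 1 \<le> A * \<rho> x * \<phi> x"
    using A_nonneg rho_nonneg phi_ge_1 by (intro mult_left_mono) auto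
  then show ?thesis using g_bound[of x] by simp
qed

lemma integrand_bound:
  assumes "0 \<le> B" "norm y \<le> B * \<rho> t" "x \<le> t"
  shows "norm (K x t * y) \<le> B * \<rho> x * h t"
proof -
  have "norm (K x t * y) \<le> norm (K x t) * (B * \<rho> t)"
    using assms by (simp add: norm_mult mult_left_mono)
  also have "\<dots> = B * (norm (K x t) * \<rho> t)" by simp
  also have "\<dots> \<le> B * (\<rho> x * h t)" using K_bound[OF assms(3)] assms(1) by (rule mult_left_mono)
  finally show ?thesis by (simp add: mult_ac)
qed

lemma integrand_integrable:
  assumes f: "f \<in> borel_measurable lebesgue" and B: "0 \<le> B" "\<And>t. norm (f t) \<le> B * \<rho> t"
  shows "set_integrable lebesgue {x..} (\<lambda>t. K x t * f t)"
  unfolding set_integrable_def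
proof (rule Bochner_Integration.integrable_bound)
  show "integrable lebesgue (\<lambda>t. B * \<rho> x * h t)" using h_integrable by simp
  have [measurable]: "K x \<in> borel_measurable lebesgue" by (rule K_measurable)
  note f[measurable]
  show "(\<lambda>t. indicat_real {x..} t *\<^sub>R (K x t * f t)) \<in> borel_measurable lebesgue"
    by (intro borel_measurable_scaleR borel_measurable_indicator borel_measurable_times K_measurable f) simp
  show "AE t in lebesgue. norm (indicat_real {x..} t *\<^sub>R (K x t * f t)) \<le> norm (B * \<rho> x * h t)"
    using integrand_bound[OF B(1) B(2)] B(1) rho_nonneg[of x] h_nonneg
    by (intro AE_I2) (auto simp: indicator_def)
qed

lemma operator_contraction:
  assumes f: "f \<in> borel_measurable lebesgue" and B: "0 \<le> B" "\<And>t. norm (f t) \<le> B * \<rho> t * \<phi> t"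
  shows "norm (LINT t:{x..}|lebesgue. K x t * f t) \<le> B / 2 * \<rho> x * \<phi> x"
proof -
  note w = tail_integral_exp_weight[OF h_integrable h_nonneg, of 4, folded \<phi>_def]
  have int: "set_integrable lebesgue {x..} (\<lambda>t. B * \<rho> x * (h t * \<phi> t))"
    using set_integrable_restrict_UNIV[OF w(1), of "{x..}"] by simp
  have "norm (LINT t:{x..}|lebesgue. K x t * f t) \<le> (LINT t:{x..}|lebesgue. B * \<rho> x * (h t * \<phi> t))"
  proof (rule set_integral_mono_norm[OF int])
    fix t assume "t \<in> {x..}"
    have "norm (f t) \<le> (B * \<phi> t) * \<rho> t" using B(2)[of t] by (simp add: mult_ac)
    then have "norm (K x t * f t) \<le> (B * \<phi> t) * \<rho> x * h t"
      using B(1) phi_ge_1[of t] \<open>t \<in> {x..}\<close> by (intro integrand_bound) auto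
    then show "norm (K x t * f t) \<le> B * \<rho> x * (h t * \<phi> t)" by (simp add: mult_ac)
  qed
  also have "\<dots> = B * \<rho> x * (LINT t:{x..}|lebesgue. h t * \<phi> t)" by simp
  also have "\<dots> \<le> B * \<rho> x * (2 / 4 * \<phi> x)"
    using w(2) B(1) rho_nonneg by (intro mult_left_mono) auto
  finally show ?thesis by simp
qed

lemma picard_measurable_bounded:
  "picard K g n \<in> borel_measurable lebesgue \<and> (\<forall>t. norm (picard K g n t) \<le> 2 * A * \<rho> t * \<phi> t)"
proof (induction n)
  case 0
  have "0 \<le> \<phi> t" for t using phi_ge_1[of t] by simp
  then show ?case using A_nonneg rho_nonneg by simp
next
  case (Suc n)
  then have IH: "picard K g n \<in> borel_measurable lebesgue"
    "norm (picard K g n t) \<le> 2 * A * \<rho> t * \<phi> t" for t by auto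
  have "norm (picard K g n t) \<le> (2 * A * \<phi>_max) * \<rho> t" for t
    using A_nonneg by (intro phi_weighted_le IH(2)) simp
  from operator_measurable[OF IH(1) this]
  have meas: "(\<lambda>x. LINT t:{x..}|lebesgue. K x t * picard K g n t) \<in> borel_measurable lebesgue" .
  have "picard K g (Suc n) = (\<lambda>x. g x - (LINT t:{x..}|lebesgue. K x t * picard K g n t))"
    by (rule ext) simp
  then have "picard K g (Suc n) \<in> borel_measurable lebesgue"
    using borel_measurable_diff[OF g_measurable meas] by (simp only:)
  moreover have "norm (picard K g (Suc n) x) \<le> 2 * A * \<rho> x * \<phi> x" for x
  proof -
    have "norm (picard K g (Suc n) x) \<le> norm (g x) + norm (LINT t:{x..}|lebesgue. K x t * picard K g n t)"
      by (simp add: norm_triangle_ineq4)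
    also have "norm (LINT t:{x..}|lebesgue. K x t * picard K g n t) \<le> (2 * A) / 2 * \<rho> x * \<phi> x"
      by (rule operator_contraction[OF IH(1)]) (use A_nonneg IH(2) in auto)
    also have "norm (g x) \<le> A * \<rho> x * \<phi> x"
      by (rule g_bound_phi)
    finally show ?thesis by simp
  qed
  ultimately show ?case by blast
qed

lemmas picard_measurable = picard_measurable_bounded[THEN conjunct1]
lemmas picard_bound = picard_measurable_bounded[THEN conjunct2, rule_format]

lemma picard_bound_rho: "norm (picard K g n t) \<le> (2 * A * \<phi>_max) * \<rho> t"
  using A_nonneg by (intro phi_weighted_le picard_bound) simp

lemma operator_diff:
  assumes "f1 \<in> borel_measurable lebesgue" "f2 \<in> borel_measurable lebesgue" "0 \<le> B"
    and "\<And>t. norm (f1 t) \<le> B * \<rho> t" "\<And>t. norm (f2 t) \<le> B * \<rho> t"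
  shows "(LINT t:{x..}|lebesgue. K x t * f1 t) - (LINT t:{x..}|lebesgue. K x t * f2 t)
      = (LINT t:{x..}|lebesgue. K x t * (f1 t - f2 t))"
  using set_integral_diff(2)[OF integrand_integrable[of f1 B x] integrand_integrable[of f2 B x]] assms
  by (simp add: right_diff_distrib)

lemma picard_step: "norm (picard K g (Suc n) x - picard K g n x) \<le> A / 2 ^ n * \<rho> x * \<phi> x"
proof (induction n arbitrary: x)
  case 0
  show ?case
    using g_bound_phi by (simp add: set_lebesgue_integral_def)
next
  case (Suc n)
  let ?U = "picard K g"
  have "?U (Suc (Suc n)) x - ?U (Suc n) x = - (LINT t:{x..}|lebesgue. K x t * (?U (Suc n) t - ?U n t))"
    by (subst operator_diff[symmetric, where B="2 * A * \<phi>_max"])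
       (use A_nonneg phi_max_ge_1 picard_measurable picard_bound_rho in \<open>simp_all del: picard.simps(2) add: picard.simps(2)[of K g "Suc n"] picard.simps(2)[of K g n x]\<close>)
  then have "norm (?U (Suc (Suc n)) x - ?U (Suc n) x) = norm (LINT t:{x..}|lebesgue. K x t * (?U (Suc n) t - ?U n t))"
    by simp
  also have "\<dots> \<le> (A / 2 ^ n) / 2 * \<rho> x * \<phi> x"
    by (rule operator_contraction) (use A_nonneg Suc picard_measurable in \<open>auto intro!: borel_measurable_diff simp del: picard.simps(2)\<close>)
  finally show ?case by (simp add: mult_ac del: picard.simps)
qed

lemma picard_diff:
  "norm (picard K g (n + j) x - picard K g n x) \<le> 2 * A * \<rho> x * \<phi> x * (1 / 2 ^ n - 1 / 2 ^ (n + j))"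
proof (induction j)
  case (Suc j)
  have "norm (picard K g (n + Suc j) x - picard K g n x)
      \<le> norm (picard K g (Suc (n + j)) x - picard K g (n + j) x) + norm (picard K g (n + j) x - picard K g n x)"
    using norm_triangle_ineq[of "picard K g (Suc (n + j)) x - picard K g (n + j) x" "picard K g (n + j) x - picard K g n x"]
    by (simp del: picard.simps)
  also have "\<dots> \<le> A / 2 ^ (n + j) * \<rho> x * \<phi> x + 2 * A * \<rho> x * \<phi> x * (1 / 2 ^ n - 1 / 2 ^ (n + j))"
    by (rule add_mono[OF picard_step Suc])
  also have "\<dots> = 2 * A * \<rho> x * \<phi> x * (1 / 2 ^ n - 1 / 2 ^ (n + Suc j))"
    by (simp add: field_simps)
  finally show ?case .
qed simp

lemma picard_diff_le:
  assumes "n \<le> m"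
  shows "norm (picard K g m x - picard K g n x) \<le> 2 * A * \<rho> x * \<phi>_max * (1 / 2) ^ n"
proof -
  obtain j where m: "m = n + j" using assms le_Suc_ex by blast
  have "norm (picard K g m x - picard K g n x) \<le> 2 * A * \<rho> x * \<phi> x * (1 / 2 ^ n - 1 / 2 ^ (n + j))"
    unfolding m by (rule picard_diff)
  also have "\<dots> \<le> 2 * A * \<rho> x * \<phi>_max * (1 / 2) ^ n"
    using A_nonneg rho_nonneg[of x] phi_le_max[of x] phi_ge_1[of x] phi_max_ge_1
    by (intro mult_mono) (auto simp: power_one_over field_simps)
  finally show ?thesis .
qed

lemma picard_tendsto: "(\<lambda>n. picard K g n x) \<longlonglongrightarrow> volterra_solution K g x"
proof -
  have "Cauchy (\<lambda>n. picard K g n x)"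
    unfolding Cauchy_altdef2
  proof (intro allI impI)
    fix e :: real assume "e > 0"
    have "(\<lambda>n. 2 * A * \<rho> x * \<phi>_max * (1 / 2) ^ n) \<longlonglongrightarrow> 2 * A * \<rho> x * \<phi>_max * 0"
      by (intro tendsto_intros LIMSEQ_power_zero) auto
    then have "\<forall>\<^sub>F n in sequentially. 2 * A * \<rho> x * \<phi>_max * (1 / 2) ^ n < e"
      using \<open>e > 0\<close> by (intro order_tendstoD(2)) auto
    then obtain N where N: "2 * A * \<rho> x * \<phi>_max * (1 / 2) ^ N < e"
      by (auto simp: eventually_sequentially)
    show "\<exists>N. \<forall>n\<ge>N. dist (picard K g n x) (picard K g N x) < e"
      using picard_diff_le[of N _ x] N by (intro exI[of _ N]) (auto simp: dist_norm intro: le_less_trans)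
  qed
  then show ?thesis
    unfolding volterra_solution_def by (simp add: Cauchy_convergent_iff convergent_LIMSEQ_iff)
qed

lemma volterra_solution_picard_diff:
  "norm (volterra_solution K g x - picard K g n x) \<le> 2 * A * \<rho> x * \<phi>_max * (1 / 2) ^ n"
proof (rule Lim_norm_ubound)
  show "(\<lambda>m. picard K g m x - picard K g n x) \<longlonglongrightarrow> volterra_solution K g x - picard K g n x"
    by (intro tendsto_intros picard_tendsto)
  show "\<forall>\<^sub>F m in sequentially. norm (picard K g m x - picard K g n x) \<le> 2 * A * \<rho> x * \<phi>_max * (1 / 2) ^ n"
    using eventually_ge_at_top[of n] by eventually_elim (rule picard_diff_le)
qed simp

lemma volterra_solution_measurable: "volterra_solution K g \<in> borel_measurable lebesgue"
  by (rule borel_measurable_LIMSEQ_metric[OF picard_measurable picard_tendsto])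

lemma volterra_solution_bound: "norm (volterra_solution K g x) \<le> (2 * A * \<phi>_max) * \<rho> x"
  using volterra_solution_picard_diff[of x 0] by (simp add: mult_ac)

lemma volterra_solution_integrable:
  "set_integrable lebesgue {x..} (\<lambda>t. K x t * volterra_solution K g t)"
  by (rule integrand_integrable[OF volterra_solution_measurable _ volterra_solution_bound])
     (use A_nonneg phi_max_ge_1 in auto)

lemma volterra_solution_eq:
  "volterra_solution K g x = g x - (LINT t:{x..}|lebesgue. K x t * volterra_solution K g t)"
proof -
  have "(\<lambda>n. LINT t:{x..}|lebesgue. K x t * picard K g n t)
      \<longlonglongrightarrow> (LINT t:{x..}|lebesgue. K x t * volterra_solution K g t)"
    unfolding set_lebesgue_integral_def
  proof (rule integral_dominated_convergence[where w="\<lambda>t. 2 * A * \<phi>_max * \<rho> x * h t"])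
    have int: "set_integrable lebesgue {x..} (\<lambda>t. K x t * picard K g n t)" for n
      by (rule integrand_integrable[OF picard_measurable _ picard_bound_rho])
         (use A_nonneg phi_max_ge_1 in auto)
    show "\<And>n. (\<lambda>t. indicat_real {x..} t *\<^sub>R (K x t * picard K g n t)) \<in> borel_measurable lebesgue"
      "(\<lambda>t. indicat_real {x..} t *\<^sub>R (K x t * volterra_solution K g t)) \<in> borel_measurable lebesgue"
      using int volterra_solution_integrable by (simp_all only: set_integrable_def borel_measurable_integrable)
    show "AE t in lebesgue. norm (indicat_real {x..} t *\<^sub>R (K x t * picard K g n t)) \<le> 2 * A * \<phi>_max * \<rho> x * h t" for n
      using integrand_bound[OF _ picard_bound_rho] A_nonneg phi_max_ge_1 rho_nonneg[of x] h_nonneg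
      by (intro AE_I2) (auto simp: indicator_def)
    show "AE t in lebesgue. (\<lambda>n. indicat_real {x..} t *\<^sub>R (K x t * picard K g n t))
        \<longlonglongrightarrow> indicat_real {x..} t *\<^sub>R (K x t * volterra_solution K g t)"
      by (intro AE_I2 tendsto_intros picard_tendsto)
  qed (use h_integrable in simp)
  then have "(\<lambda>n. picard K g (Suc n) x) \<longlonglongrightarrow> g x - (LINT t:{x..}|lebesgue. K x t * volterra_solution K g t)"
    by (auto intro!: tendsto_intros)
  moreover have "(\<lambda>n. picard K g (Suc n) x) \<longlonglongrightarrow> volterra_solution K g x"
    by (rule LIMSEQ_Suc[OF picard_tendsto])
  ultimately show ?thesis using LIMSEQ_unique by blast
qed

end

text \<open>The weights \<open>\<rho>\<close>, \<open>h\<close> and the bound \<open>A\<close> are common to all parameters in \<open>\<Omega>\<close>, and they alone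
  determine the rate of convergence of the Picard iterates. So the convergence is uniform on \<open>\<Omega>\<close>.\<close>

lemma volterra_solution_holomorphic:
  assumes \<Omega>: "open \<Omega>"
    and V: "\<And>l. l \<in> \<Omega> \<Longrightarrow> weighted_volterra (K l) (g l) \<rho> h A"
    and K_hol: "\<And>x t. (\<lambda>l. K l x t) holomorphic_on \<Omega>"
    and g_hol: "\<And>x. (\<lambda>l. g l x) holomorphic_on \<Omega>"
  shows "(\<lambda>l. volterra_solution (K l) (g l) x) holomorphic_on \<Omega>"
proof (cases "\<Omega> = {}")
  case False
  then obtain l0 where "l0 \<in> \<Omega>" by blast
  interpret V0: weighted_volterra "K l0" "g l0" \<rho> h A by (rule V) fact
  have picard_hol: "(\<lambda>l. picard (K l) (g l) n x) holomorphic_on \<Omega>" for n x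
  proof (induction n arbitrary: x)
    case (Suc n)
    have "(\<lambda>l. LINT t|lebesgue. indicat_real {x..} t *\<^sub>R (K l x t * picard (K l) (g l) n t)) holomorphic_on \<Omega>"
    proof (rule holomorphic_on_integral[OF \<Omega>])
      fix l assume "l \<in> \<Omega>"
      interpret weighted_volterra "K l" "g l" \<rho> h A by (rule V) fact
      have "set_integrable lebesgue {x..} (\<lambda>t. K l x t * picard (K l) (g l) n t)"
        by (rule integrand_integrable[OF picard_measurable _ picard_bound_rho])
           (use A_nonneg phi_max_ge_1 in auto)
      then show "(\<lambda>t. indicat_real {x..} t *\<^sub>R (K l x t * picard (K l) (g l) n t)) \<in> borel_measurable lebesgue"
        by (simp only: set_integrable_def borel_measurable_integrable)
      show "norm (indicat_real {x..} t *\<^sub>R (K l x t * picard (K l) (g l) n t)) \<le> 2 * A * \<phi>_max * \<rho> x * h t" for t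
        using integrand_bound[OF _ picard_bound_rho] A_nonneg phi_max_ge_1 rho_nonneg[of x] h_nonneg
        by (auto simp: indicator_def)
    next
      show "integrable lebesgue (\<lambda>t. 2 * A * V0.\<phi>_max * \<rho> x * h t)" using V0.h_integrable by simp
      show "(\<lambda>l. indicat_real {x..} t *\<^sub>R (K l x t * picard (K l) (g l) n t)) holomorphic_on \<Omega>" for t
        unfolding scaleR_conv_of_real by (intro holomorphic_intros K_hol Suc)
    qed
    then show ?case by (auto simp: set_lebesgue_integral_def intro!: holomorphic_intros g_hol)
  qed simp
  show ?thesis
  proof (rule holomorphic_uniform_sequence[OF \<Omega> picard_hol])
    fix l assume "l \<in> \<Omega>"
    then obtain d where d: "d > 0" "cball l d \<subseteq> \<Omega>" using \<Omega> open_contains_cball by blast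
    have "uniform_limit (cball l d) (\<lambda>n l. picard (K l) (g l) n x) (\<lambda>l. volterra_solution (K l) (g l) x) sequentially"
    proof (rule uniform_limitI)
      fix e :: real assume "e > 0"
      have "(\<lambda>n. 2 * A * \<rho> x * V0.\<phi>_max * (1 / 2) ^ n) \<longlonglongrightarrow> 2 * A * \<rho> x * V0.\<phi>_max * 0"
        by (intro tendsto_intros LIMSEQ_power_zero) auto
      then have "\<forall>\<^sub>F n in sequentially. 2 * A * \<rho> x * V0.\<phi>_max * (1 / 2) ^ n < e"
        using \<open>e > 0\<close> by (intro order_tendstoD(2)) auto
      then show "\<forall>\<^sub>F n in sequentially. \<forall>l\<in>cball l d.
          dist (picard (K l) (g l) n x) (volterra_solution (K l) (g l) x) < e"
      proof (eventually_elim, intro ballI)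
        fix n l' assume n: "2 * A * \<rho> x * V0.\<phi>_max * (1 / 2) ^ n < e" and "l' \<in> cball l d"
        then interpret weighted_volterra "K l'" "g l'" \<rho> h A using d by (intro V) blast
        show "dist (picard (K l') (g l') n x) (volterra_solution (K l') (g l') x) < e"
          using volterra_solution_picard_diff[of x n] n by (simp add: dist_norm norm_minus_commute)
      qed
    qed
    then show "\<exists>d>0. cball l d \<subseteq> \<Omega> \<and>
        uniform_limit (cball l d) (\<lambda>n l. picard (K l) (g l) n x) (\<lambda>l. volterra_solution (K l) (g l) x) sequentially"
      using d by blast
  qed
qed (simp add: holomorphic_on_def)

section \<open>Absolute continuity by an integral majorant\<close>

text \<open>A form of absolute continuity on \<open>[b, c]\<close> whose stability under sums and products is a direct
  estimate; tail integrals have it, with the norm of the integrand for \<open>H\<close>. The function \<open>H\<close> plays the role of a majorant of \<open>|F'|\<close>.\<close>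

definition integral_dominated :: "real \<Rightarrow> real \<Rightarrow> (real \<Rightarrow> complex) \<Rightarrow> bool" where
  "integral_dominated b c F \<longleftrightarrow> (\<exists>H. integrable lebesgue H \<and> (\<forall>t. 0 \<le> H t) \<and>
     (\<forall>u v. b \<le> u \<longrightarrow> u \<le> v \<longrightarrow> v \<le> c \<longrightarrow> norm (F v - F u) \<le> (LINT t:{u..<v}|lebesgue. H t)))"

lemma integral_dominated_imp_abs_continuous:
  "integral_dominated b c F \<Longrightarrow> abs_continuous_on_interval b c F"
  unfolding integral_dominated_def using abs_continuous_on_interval_if_integral_bound by blast

lemma integral_dominated_tail:
  assumes "integrable lebesgue f"
  shows "integral_dominated b c (\<lambda>x. LINT t:{x..}|lebesgue. f t)"
  unfolding integral_dominated_def
proof (intro exI[of _ "\<lambda>t. norm (f t)"] conjI allI impI)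
  fix u v :: real assume "u \<le> v"
  have "norm ((LINT t:{v..}|lebesgue. f t) - (LINT t:{u..}|lebesgue. f t)) = norm (LINT t:{u..<v}|lebesgue. f t)"
    using tail_integral_split[OF assms \<open>u \<le> v\<close>] by (simp add: norm_minus_commute)
  also have "\<dots> \<le> (LINT t:{u..<v}|lebesgue. norm (f t))"
    by (rule set_integral_mono_norm) (use assms in \<open>auto intro!: set_integrable_restrict_UNIV\<close>)
  finally show "norm ((LINT t:{v..}|lebesgue. f t) - (LINT t:{u..}|lebesgue. f t)) \<le> (LINT t:{u..<v}|lebesgue. norm (f t))" .
qed (use assms in auto)

lemma integral_dominated_lipschitz:
  assumes "\<And>u v. b \<le> u \<Longrightarrow> u \<le> v \<Longrightarrow> v \<le> c \<Longrightarrow> norm (F v - F u) \<le> L * (v - u)" "0 \<le> L"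
  shows "integral_dominated b c F"
  unfolding integral_dominated_def
proof (intro exI[of _ "\<lambda>t. L * indicat_real {b..c} t"] conjI allI impI)
  show "integrable lebesgue (\<lambda>t. L * indicat_real {b..c} t)"
    by (cases "b \<le> c") auto
  fix u v :: real assume uv: "b \<le> u" "u \<le> v" "v \<le> c"
  have "(LINT t:{u..<v}|lebesgue. L * indicat_real {b..c} t) = (LINT t:{u..<v}|lebesgue. L)"
    by (rule set_lebesgue_integral_cong) (use uv in auto)
  also have "\<dots> = L * (v - u)" using uv by (simp add: set_lebesgue_integral_def)
  finally show "norm (F v - F u) \<le> (LINT t:{u..<v}|lebesgue. L * indicat_real {b..c} t)"
    using assms(1)[OF uv] by (simp only:)
qed (use assms in auto)

lemma integral_dominated_bounded:
  assumes "integral_dominated b c F"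
  obtains B where "0 \<le> B" "\<And>x. b \<le> x \<Longrightarrow> x \<le> c \<Longrightarrow> norm (F x) \<le> B"
proof -
  obtain H where H: "integrable lebesgue H" "\<And>t. 0 \<le> H t"
    "\<And>u v. b \<le> u \<Longrightarrow> u \<le> v \<Longrightarrow> v \<le> c \<Longrightarrow> norm (F v - F u) \<le> (LINT t:{u..<v}|lebesgue. H t)"
    using assms unfolding integral_dominated_def by blast
  show thesis
  proof (rule that[of "norm (F b) + integral\<^sup>L lebesgue H"])
    show "0 \<le> norm (F b) + integral\<^sup>L lebesgue H" using H(2) by (simp add: integral_nonneg_AE)
    fix x assume x: "b \<le> x" "x \<le> c"
    have "norm (F x - F b) \<le> (LINT t:{b..<x}|lebesgue. H t)" using H(3) x by simp
    also have "\<dots> \<le> integral\<^sup>L lebesgue H"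
      unfolding set_lebesgue_integral_def
      by (intro integral_mono integrable_mult_indicator H) (auto simp: indicator_def H(2))
    finally show "norm (F x) \<le> norm (F b) + integral\<^sup>L lebesgue H"
      using norm_triangle_ineq2[of "F x" "F b"] by simp
  qed
qed

lemma integral_dominated_combine:
  assumes F: "integral_dominated b c F" and G: "integral_dominated b c G"
    and B: "\<And>u v. b \<le> u \<Longrightarrow> u \<le> v \<Longrightarrow> v \<le> c \<Longrightarrow>
      norm (E v - E u) \<le> B * norm (F v - F u) + B * norm (G v - G u)" "0 \<le> B"
  shows "integral_dominated b c E"
proof -
  obtain H1 where H1: "integrable lebesgue H1" "\<And>t. 0 \<le> H1 t"
    "\<And>u v. b \<le> u \<Longrightarrow> u \<le> v \<Longrightarrow> v \<le> c \<Longrightarrow> norm (F v - F u) \<le> (LINT t:{u..<v}|lebesgue. H1 t)"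
    using F unfolding integral_dominated_def by blast
  obtain H2 where H2: "integrable lebesgue H2" "\<And>t. 0 \<le> H2 t"
    "\<And>u v. b \<le> u \<Longrightarrow> u \<le> v \<Longrightarrow> v \<le> c \<Longrightarrow> norm (G v - G u) \<le> (LINT t:{u..<v}|lebesgue. H2 t)"
    using G unfolding integral_dominated_def by blast
  show ?thesis
    unfolding integral_dominated_def
  proof (intro exI[of _ "\<lambda>t. B * H1 t + B * H2 t"] conjI allI impI)
    show "integrable lebesgue (\<lambda>t. B * H1 t + B * H2 t)" using H1 H2 by simp
    show "0 \<le> B * H1 t + B * H2 t" for t using H1(2) H2(2) B(2) by simp
    fix u v :: real assume uv: "b \<le> u" "u \<le> v" "v \<le> c"
    have "norm (E v - E u) \<le> B * (LINT t:{u..<v}|lebesgue. H1 t) + B * (LINT t:{u..<v}|lebesgue. H2 t)"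
      using order_trans[OF B(1)[OF uv] add_mono[OF mult_left_mono[OF H1(3)[OF uv] B(2)] mult_left_mono[OF H2(3)[OF uv] B(2)]]] .
    also have "\<dots> = (LINT t:{u..<v}|lebesgue. B * H1 t + B * H2 t)"
      by (subst set_integral_add(2)) (use H1 H2 in \<open>auto intro!: set_integrable_restrict_UNIV\<close>)
    finally show "norm (E v - E u) \<le> (LINT t:{u..<v}|lebesgue. B * H1 t + B * H2 t)" .
  qed
qed

lemma integral_dominated_add:
  assumes "integral_dominated b c F" "integral_dominated b c G"
  shows "integral_dominated b c (\<lambda>x. F x + G x)"
proof (rule integral_dominated_combine[OF assms, where B=1])
  fix u v
  show "norm (F v + G v - (F u + G u)) \<le> 1 * norm (F v - F u) + 1 * norm (G v - G u)"
    using norm_triangle_ineq[of "F v - F u" "G v - G u"] by (simp add: add_diff_add)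
qed simp

lemma integral_dominated_mult:
  assumes F: "integral_dominated b c F" and G: "integral_dominated b c G"
  shows "integral_dominated b c (\<lambda>x. F x * G x)"
proof -
  obtain B1 where B1: "0 \<le> B1" "\<And>x. b \<le> x \<Longrightarrow> x \<le> c \<Longrightarrow> norm (F x) \<le> B1"
    using integral_dominated_bounded[OF F] by blast
  obtain B2 where B2: "0 \<le> B2" "\<And>x. b \<le> x \<Longrightarrow> x \<le> c \<Longrightarrow> norm (G x) \<le> B2"
    using integral_dominated_bounded[OF G] by blast
  show ?thesis
  proof (rule integral_dominated_combine[OF F G, where B="B1 + B2"])
    fix u v :: real assume uv: "b \<le> u" "u \<le> v" "v \<le> c"
    have "F v * G v - F u * G u = G v * (F v - F u) + F u * (G v - G u)" by (simp add: algebra_simps)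
    then have "norm (F v * G v - F u * G u) \<le> norm (G v) * norm (F v - F u) + norm (F u) * norm (G v - G u)"
      by (metis norm_mult norm_triangle_ineq)
    also have "\<dots> \<le> (B1 + B2) * norm (F v - F u) + (B1 + B2) * norm (G v - G u)"
      using B1(1) B2(1) B2(2)[of v] B1(2)[of u] uv by (intro add_mono mult_right_mono) auto
    finally show "norm (F v * G v - F u * G u) \<le> \<dots>" .
  qed (use B1 B2 in simp)
qed

lemma integral_dominated_const: "integral_dominated b c (\<lambda>x. z)"
  by (rule integral_dominated_lipschitz[where L=0]) auto

lemma integral_dominated_sum:
  "finite J \<Longrightarrow> (\<And>j. j \<in> J \<Longrightarrow> integral_dominated b c (F j)) \<Longrightarrow> integral_dominated b c (\<lambda>x. \<Sum>j\<in>J. F j x)"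
  by (induction J rule: finite_induct) (auto intro: integral_dominated_add integral_dominated_const)

lemma exp_line_derivative:
  "((\<lambda>x. exp (\<nu> * complex_of_real x)) has_vector_derivative \<nu> * exp (\<nu> * of_real x)) (at x within S)"
  by (rule has_vector_derivative_real_field) (auto intro!: derivative_eq_intros)

lemma integral_dominated_exp: "integral_dominated b c (\<lambda>x. exp (\<nu> * of_real x))"
proof -
  define L where "L = norm \<nu> * exp (norm \<nu> * (\<bar>b\<bar> + \<bar>c\<bar>))"
  show ?thesis
  proof (rule integral_dominated_lipschitz[where L=L])
    fix u v :: real assume uv: "b \<le> u" "u \<le> v" "v \<le> c"
    have "norm (exp (\<nu> * of_real v) - exp (\<nu> * of_real u)) \<le> L * norm (v - u)"
    proof (rule differentiable_bound[of "{b..c}" _ "\<lambda>x h. h *\<^sub>R (\<nu> * exp (\<nu> * of_real x))"])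
      fix x assume x: "x \<in> {b..c}"
      show "((\<lambda>x. exp (\<nu> * complex_of_real x)) has_derivative (\<lambda>h. h *\<^sub>R (\<nu> * exp (\<nu> * of_real x)))) (at x within {b..c})"
        using exp_line_derivative[of \<nu> x "{b..c}"] by (simp add: has_vector_derivative_def)
      have "norm (exp (\<nu> * complex_of_real x)) \<le> exp (norm \<nu> * (\<bar>b\<bar> + \<bar>c\<bar>))"
        by (rule order_trans[OF norm_exp]) (use x in \<open>auto simp: norm_mult intro!: mult_left_mono\<close>)
      then show "onorm (\<lambda>h. h *\<^sub>R (\<nu> * exp (\<nu> * complex_of_real x))) \<le> L"
        by (intro onorm_le) (auto simp: L_def norm_mult mult.commute[of "\<bar>_\<bar>"] intro!: mult_mono)
    qed (use uv in auto)
    then show "norm (exp (\<nu> * of_real v) - exp (\<nu> * of_real u)) \<le> L * (v - u)" using uv by simp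
  qed (simp add: L_def)
qed

section \<open>Convolution with sums of exponentials\<close>

text \<open>Near \<open>x\<close> the factor \<open>\<kappa>\<close> is \<open>O(|t - x|)\<close>, so an increment of the tail integral over an interval
  from \<open>x\<close> to \<open>y\<close> is at most a multiple of \<open>|y - x|\<close> times the integral of \<open>|F|\<close> over that interval, and this
  integral tends to \<open>0\<close>.\<close>

lemma tail_integral_derivative_zero:
  fixes F \<kappa> :: "real \<Rightarrow> complex"
  assumes F: "integrable lebesgue F" and \<kappa>F: "integrable lebesgue (\<lambda>t. \<kappa> t * F t)"
    and \<kappa>: "(\<kappa> has_vector_derivative d) (at x)" "\<kappa> x = 0"
  shows "((\<lambda>x. LINT t:{x..}|lebesgue. \<kappa> t * F t) has_vector_derivative 0) (at x)"
proof -
  let ?T = "\<lambda>x. LINT t:{x..}|lebesgue. \<kappa> t * F t" and ?N = "\<lambda>x. LINT t:{x..}|lebesgue. norm (F t)"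
  define C where "C = norm d + 1"
  have "((\<lambda>y. norm ((\<kappa> y - \<kappa> x) /\<^sub>R (y - x))) \<longlongrightarrow> norm d) (at x)"
    using \<kappa>(1) unfolding has_vector_derivative_iff_quotient by (rule tendsto_norm)
  then have "\<forall>\<^sub>F y in at x. norm ((\<kappa> y - \<kappa> x) /\<^sub>R (y - x)) < C"
    by (rule order_tendstoD(2)) (simp add: C_def)
  moreover have "\<forall>\<^sub>F y in at x. y \<noteq> x" by (simp add: eventually_at_filter)
  ultimately have "\<forall>\<^sub>F y in at x. norm (\<kappa> y) \<le> C * \<bar>y - x\<bar>"
    by eventually_elim (simp add: \<kappa>(2) field_simps)
  then obtain \<delta> where \<delta>: "\<delta> > 0" "\<And>y. dist y x < \<delta> \<Longrightarrow> norm (\<kappa> y) \<le> C * \<bar>y - x\<bar>"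
    unfolding eventually_at using \<kappa>(2) by (metis UNIV_I abs_zero diff_self mult_zero_right norm_zero order_refl)
  have "0 \<le> C" by (simp add: C_def)
  have piece: "norm (?T u - ?T v) \<le> C * (v - u) * (?N u - ?N v)"
    if "u \<le> v" "x - \<delta> < u" "v < x + \<delta>" "u \<le> x" "x \<le> v" for u v
  proof -
    have "?T u - ?T v = (LINT t:{u..<v}|lebesgue. \<kappa> t * F t)"
      using tail_integral_split[OF \<kappa>F \<open>u \<le> v\<close>] by simp
    also have "norm \<dots> \<le> (LINT t:{u..<v}|lebesgue. C * (v - u) * norm (F t))"
    proof (rule set_integral_mono_norm)
      fix t assume "t \<in> {u..<v}"
      then have "norm (\<kappa> t) \<le> C * \<bar>t - x\<bar>" using that by (intro \<delta>) (auto simp: dist_real_def)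
      also have "\<dots> \<le> C * (v - u)" using \<open>t \<in> {u..<v}\<close> that \<open>0 \<le> C\<close> by (intro mult_left_mono) auto
      finally show "norm (\<kappa> t * F t) \<le> C * (v - u) * norm (F t)"
        by (simp add: norm_mult mult_right_mono)
    qed (use F in \<open>auto intro!: set_integrable_restrict_UNIV\<close>)
    also have "\<dots> = C * (v - u) * (LINT t:{u..<v}|lebesgue. norm (F t))" by simp
    also have "(LINT t:{u..<v}|lebesgue. norm (F t)) = ?N u - ?N v"
      using tail_integral_split[OF integrable_norm[OF F] \<open>u \<le> v\<close>] by simp
    finally show ?thesis .
  qed
  have bd: "norm (?T y - ?T x) \<le> C * \<bar>y - x\<bar> * \<bar>?N y - ?N x\<bar>" if "dist y x < \<delta>" for y
  proof (cases "y \<le> x")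
    case True
    have "norm (?T y - ?T x) \<le> C * (x - y) * (?N y - ?N x)"
      using True that \<delta>(1) by (intro piece) (auto simp: dist_real_def)
    also have "\<dots> \<le> C * (x - y) * \<bar>?N y - ?N x\<bar>" using \<open>0 \<le> C\<close> True by (intro mult_left_mono) auto
    finally show ?thesis using True by simp
  next
    case False
    have "norm (?T x - ?T y) \<le> C * (y - x) * (?N x - ?N y)"
      using False that \<delta>(1) by (intro piece) (auto simp: dist_real_def)
    also have "\<dots> \<le> C * (y - x) * \<bar>?N y - ?N x\<bar>" using \<open>0 \<le> C\<close> False by (intro mult_left_mono) auto
    finally show ?thesis using False by (simp add: norm_minus_commute)
  qed
  have "isCont ?N x"
    using continuous_on_tail_integral[OF integrable_norm[OF F]] by (simp add: continuous_on_eq_continuous_at)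
  then have "((\<lambda>y. C * \<bar>?N y - ?N x\<bar>) \<longlongrightarrow> C * \<bar>?N x - ?N x\<bar>) (at x)"
    unfolding isCont_def by (intro tendsto_intros)
  then have lim: "((\<lambda>y. C * \<bar>?N y - ?N x\<bar>) \<longlongrightarrow> 0) (at x)" by simp
  show ?thesis
    unfolding has_vector_derivative_iff_quotient
  proof (rule Lim_null_comparison[OF _ lim])
    show "\<forall>\<^sub>F y in at x. norm ((?T y - ?T x) /\<^sub>R (y - x)) \<le> C * \<bar>?N y - ?N x\<bar>"
      unfolding eventually_at
    proof (intro exI[of _ \<delta>] conjI ballI impI \<delta>(1))
      fix y assume y: "y \<noteq> x \<and> dist y x < \<delta>"
      then have "\<bar>y - x\<bar> > 0" by simp
      have "norm ((?T y - ?T x) /\<^sub>R (y - x)) = norm (?T y - ?T x) / \<bar>y - x\<bar>"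
        by (simp only: norm_scaleR abs_inverse divide_inverse mult.commute)
      also have "\<dots> \<le> C * \<bar>?N y - ?N x\<bar>"
        using bd[of y] y \<open>\<bar>y - x\<bar> > 0\<close> by (simp only: pos_divide_le_eq mult_ac)
      finally show "norm ((?T y - ?T x) /\<^sub>R (y - x)) \<le> C * \<bar>?N y - ?N x\<bar>" .
    qed
  qed
qed

text \<open>Convolutions of \<open>w\<close>, over the half lines \<open>[x, \<infinity>)\<close>, with a sum of exponentials. The kernel is separable,
  so all of them are combinations of the tail integrals \<open>W j\<close>.\<close>

locale exponential_convolution =
  fixes J :: "'j set" and \<nu> :: "'j \<Rightarrow> complex" and w :: "real \<Rightarrow> complex"
  assumes finite_J: "finite J"
    and integrable_exp: "j \<in> J \<Longrightarrow> integrable lebesgue (\<lambda>t. exp (- \<nu> j * of_real t) * w t)"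
begin

definition W :: "'j \<Rightarrow> real \<Rightarrow> complex" where
  "W j x = (LINT t:{x..}|lebesgue. exp (- \<nu> j * of_real t) * w t)"

definition conv :: "('j \<Rightarrow> complex) \<Rightarrow> real \<Rightarrow> complex" where
  "conv \<alpha> x = (LINT t:{x..}|lebesgue. (\<Sum>j\<in>J. \<alpha> j * exp (\<nu> j * of_real (x - t))) * w t)"

lemma integrand_eq:
  "(\<Sum>j\<in>J. \<alpha> j * exp (\<nu> j * of_real (x - t))) * w t
    = (\<Sum>j\<in>J. \<alpha> j * exp (\<nu> j * of_real x) * (exp (- \<nu> j * of_real t) * w t))"
  unfolding sum_distrib_right
  by (intro sum.cong refl) (simp add: algebra_simps exp_diff exp_minus divide_inverse)

lemma integrable_integrand:
  "integrable lebesgue (\<lambda>t. (\<Sum>j\<in>J. \<alpha> j * exp (\<nu> j * of_real (x - t))) * w t)"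
  unfolding integrand_eq using integrable_exp
  by (intro Bochner_Integration.integrable_sum integrable_mult_right) auto

lemma tail_integral_combination:
  "(LINT t:{x..}|lebesgue. \<Sum>j\<in>J. c j * (exp (- \<nu> j * of_real t) * w t)) = (\<Sum>j\<in>J. c j * W j x)"
proof -
  have "(LINT t:{x..}|lebesgue. \<Sum>j\<in>J. c j * (exp (- \<nu> j * of_real t) * w t))
      = (LINT t|lebesgue. (\<Sum>j\<in>J. indicat_real {x..} t *\<^sub>R (c j * (exp (- \<nu> j * of_real t) * w t))))"
    unfolding set_lebesgue_integral_def by (simp add: scaleR_sum_right)
  also have "\<dots> = (\<Sum>j\<in>J. LINT t|lebesgue. indicat_real {x..} t *\<^sub>R (c j * (exp (- \<nu> j * of_real t) * w t)))"
    using integrable_exp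
    by (intro Bochner_Integration.integral_sum integrable_mult_indicator integrable_mult_right) auto
  also have "\<dots> = (\<Sum>j\<in>J. c j * W j x)"
    unfolding W_def set_lebesgue_integral_def
    by (intro sum.cong refl) (simp flip: integral_mult_right_zero)
  finally show ?thesis .
qed

lemma conv_eq: "conv \<alpha> x = (\<Sum>j\<in>J. \<alpha> j * exp (\<nu> j * of_real x) * W j x)"
  unfolding conv_def integrand_eq by (rule tail_integral_combination)

lemma W_continuous: "j \<in> J \<Longrightarrow> continuous_on UNIV (W j)"
  unfolding W_def by (intro continuous_on_tail_integral integrable_exp)

lemma conv_continuous: "continuous_on UNIV (conv \<alpha>)"
  unfolding conv_eq by (intro continuous_intros W_continuous)

lemma conv_integral_dominated: "integral_dominated b c (conv \<alpha>)"
  unfolding conv_eq W_def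
  by (intro integral_dominated_sum integral_dominated_mult integral_dominated_const
      integral_dominated_exp integral_dominated_tail integrable_exp finite_J)

text \<open>The product rule for \<open>exp (\<nu> j * x) * W j x\<close>; the derivative of \<open>W j\<close> contributes \<open>- w x\<close>, since the
  two exponentials cancel.\<close>

lemma AE_conv_derivative:
  "AE x in lebesgue. (conv \<alpha> has_vector_derivative
     (conv (\<lambda>j. \<alpha> j * \<nu> j) x - (\<Sum>j\<in>J. \<alpha> j) * w x)) (at x)"
proof -
  have "AE x in lebesgue. \<forall>j\<in>J. (W j has_vector_derivative - (exp (- \<nu> j * of_real x) * w x)) (at x)"
    unfolding W_def by (intro AE_finite_allI finite_J AE_tail_integral_derivative integrable_exp)
  then show ?thesis
  proof eventually_elim
    case (elim x)
    have "((\<lambda>y. \<Sum>j\<in>J. \<alpha> j * (exp (\<nu> j * of_real y) * W j y)) has_vector_derivative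
        (\<Sum>j\<in>J. \<alpha> j * (exp (\<nu> j * of_real x) * - (exp (- \<nu> j * of_real x) * w x) + \<nu> j * exp (\<nu> j * of_real x) * W j x))) (at x)"
      using elim
      by (intro has_vector_derivative_sum has_vector_derivative_mult_right has_vector_derivative_mult exp_line_derivative) auto
    moreover have "(\<Sum>j\<in>J. \<alpha> j * (exp (\<nu> j * of_real x) * - (exp (- \<nu> j * of_real x) * w x) + \<nu> j * exp (\<nu> j * of_real x) * W j x))
        = conv (\<lambda>j. \<alpha> j * \<nu> j) x - (\<Sum>j\<in>J. \<alpha> j) * w x"
      unfolding conv_eq sum_distrib_right sum_subtractf[symmetric]
      by (intro sum.cong refl) (simp add: exp_minus algebra_simps)
    moreover have "conv \<alpha> = (\<lambda>y. \<Sum>j\<in>J. \<alpha> j * (exp (\<nu> j * of_real y) * W j y))"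
      by (simp add: fun_eq_iff conv_eq mult_ac)
    ultimately show ?case by simp
  qed
qed

text \<open>The functions \<open>W j\<close> need not be differentiable at the given \<open>x\<close>. So the increment of \<open>conv \<alpha>\<close> is
  split: in one part only the exponentials move, and continuity of \<open>W j\<close> suffices; in the other the
  exponentials are fixed at \<open>x\<close>, and its integrand has the factor \<open>\<Sum>j\<in>J. \<alpha> j * exp (\<nu> j * (x - t))\<close>,
  which vanishes at \<open>t = x\<close> by assumption.\<close>

lemma conv_derivative:
  assumes "(\<Sum>j\<in>J. \<alpha> j) = 0"
  shows "(conv \<alpha> has_vector_derivative conv (\<lambda>j. \<alpha> j * \<nu> j) x) (at x)"
proof (cases "J = {}")
  case True
  then have "conv \<beta> = (\<lambda>x. 0)" for \<beta> by (intro ext, subst conv_eq) (simp add: True)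
  then show ?thesis by simp
next
  case False
  then obtain j0 where j0: "j0 \<in> J" by blast
  \<comment> \<open>\<open>w\<close> itself may fail to be integrable; multiplication by one of the exponentials repairs this.\<close>
  define F where "F = (\<lambda>t. exp (- \<nu> j0 * of_real t) * w t)"
  define \<kappa> where "\<kappa> = (\<lambda>t. (\<Sum>j\<in>J. \<alpha> j * exp (\<nu> j * of_real (x - t))) * exp (\<nu> j0 * complex_of_real t))"
  have \<kappa>F: "\<kappa> t * F t = (\<Sum>j\<in>J. \<alpha> j * exp (\<nu> j * of_real (x - t))) * w t" for t
    by (simp add: \<kappa>_def F_def exp_minus)
  have "((\<lambda>y. LINT t:{y..}|lebesgue. \<kappa> t * F t) has_vector_derivative 0) (at x)"
  proof (rule tail_integral_derivative_zero)
    show "integrable lebesgue F" unfolding F_def by (rule integrable_exp[OF j0])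
    show "integrable lebesgue (\<lambda>t. \<kappa> t * F t)" unfolding \<kappa>F by (rule integrable_integrand)
    show "\<kappa> x = 0" using assms by (simp add: \<kappa>_def)
    have "\<kappa> = (\<lambda>t. \<Sum>j\<in>J. \<alpha> j * exp (\<nu> j * of_real x) * exp ((\<nu> j0 - \<nu> j) * complex_of_real t))"
      unfolding \<kappa>_def sum_distrib_right
      by (intro ext sum.cong refl) (simp add: algebra_simps exp_diff exp_minus divide_inverse)
    moreover have "((\<lambda>t. \<Sum>j\<in>J. \<alpha> j * exp (\<nu> j * of_real x) * exp ((\<nu> j0 - \<nu> j) * complex_of_real t)) has_vector_derivative
       (\<Sum>j\<in>J. \<alpha> j * exp (\<nu> j * of_real x) * ((\<nu> j0 - \<nu> j) * exp ((\<nu> j0 - \<nu> j) * of_real x)))) (at x)"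
      by (intro has_vector_derivative_sum has_vector_derivative_mult_right exp_line_derivative)
    ultimately show "(\<kappa> has_vector_derivative
       (\<Sum>j\<in>J. \<alpha> j * exp (\<nu> j * of_real x) * ((\<nu> j0 - \<nu> j) * exp ((\<nu> j0 - \<nu> j) * of_real x)))) (at x)"
      by simp
  qed
  moreover have "(LINT t:{y..}|lebesgue. \<kappa> t * F t) = (\<Sum>j\<in>J. \<alpha> j * exp (\<nu> j * of_real x) * W j y)" for y
    unfolding \<kappa>F integrand_eq by (rule tail_integral_combination)
  ultimately have tail_part: "((\<lambda>y. \<Sum>j\<in>J. \<alpha> j * exp (\<nu> j * of_real x) * W j y) has_vector_derivative 0) (at x)"
    by simp
  have exp_part: "((\<lambda>y. \<alpha> j * ((exp (\<nu> j * of_real y) - exp (\<nu> j * of_real x)) * W j y)) has_vector_derivative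
      \<alpha> j * (\<nu> j * exp (\<nu> j * of_real x) * W j x)) (at x)" if "j \<in> J" for j
  proof (rule has_vector_derivative_mult_right)
    have "((\<lambda>y. (exp (\<nu> j * complex_of_real y) - exp (\<nu> j * of_real x)) /\<^sub>R (y - x)) \<longlongrightarrow> \<nu> j * exp (\<nu> j * of_real x)) (at x)"
      using exp_line_derivative[of "\<nu> j" x UNIV] by (simp add: has_vector_derivative_iff_quotient)
    moreover have "(W j \<longlongrightarrow> W j x) (at x)"
      using W_continuous[OF that] by (simp add: continuous_on_def)
    ultimately have "((\<lambda>y. (exp (\<nu> j * complex_of_real y) - exp (\<nu> j * of_real x)) /\<^sub>R (y - x) * W j y)
        \<longlongrightarrow> \<nu> j * exp (\<nu> j * of_real x) * W j x) (at x)"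
      by (rule tendsto_mult)
    then show "((\<lambda>y. (exp (\<nu> j * of_real y) - exp (\<nu> j * of_real x)) * W j y) has_vector_derivative
      \<nu> j * exp (\<nu> j * of_real x) * W j x) (at x)"
      by (simp add: has_vector_derivative_iff_quotient)
  qed
  have "((\<lambda>y. (\<Sum>j\<in>J. \<alpha> j * ((exp (\<nu> j * of_real y) - exp (\<nu> j * of_real x)) * W j y))
        + (\<Sum>j\<in>J. \<alpha> j * exp (\<nu> j * of_real x) * W j y)) has_vector_derivative
      (\<Sum>j\<in>J. \<alpha> j * (\<nu> j * exp (\<nu> j * of_real x) * W j x)) + 0) (at x)"
    by (intro has_vector_derivative_add has_vector_derivative_sum exp_part tail_part)
  moreover have "conv \<alpha> = (\<lambda>y. (\<Sum>j\<in>J. \<alpha> j * ((exp (\<nu> j * of_real y) - exp (\<nu> j * of_real x)) * W j y))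
        + (\<Sum>j\<in>J. \<alpha> j * exp (\<nu> j * of_real x) * W j y))"
    unfolding sum.distrib[symmetric] by (simp add: fun_eq_iff conv_eq algebra_simps)
  moreover have "conv (\<lambda>j. \<alpha> j * \<nu> j) x = (\<Sum>j\<in>J. \<alpha> j * (\<nu> j * exp (\<nu> j * of_real x) * W j x)) + 0"
    by (simp add: conv_eq mult_ac)
  ultimately show ?thesis by simp
qed

end

section \<open>The fundamental solution of the unperturbed equation\<close>

lemma zeta_simps:
  "zeta 0 = 1" "zeta (Suc 0) = Complex (- 1 / 2) (sqrt 3 / 2)" "zeta 2 = Complex (- 1 / 2) (- (sqrt 3 / 2))"
  by (auto simp: zeta_def complex_eq_iff)

lemma sum_atMost_2: "(\<Sum>j\<le>(2::nat). f j) = f 0 + f (Suc 0) + f 2"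
  by (simp add: numeral_2_eq_2)

lemma zeta_cubed: "zeta j ^ 3 = 1"
proof -
  have root: "Complex (- 1 / 2) y ^ 3 = 1" if "y * y = 3 / 4" for y
  proof -
    have "Complex (- 1 / 2) y * Complex (- 1 / 2) y = Complex (- 1 / 2) (- y)"
      using that by (simp add: complex_eq_iff)
    then have "Complex (- 1 / 2) y ^ 3 = Complex (- 1 / 2) (- y) * Complex (- 1 / 2) y"
      by (simp only: power3_eq_cube)
    also have "\<dots> = 1" using that by (simp add: complex_eq_iff)
    finally show ?thesis .
  qed
  have "zeta j = zeta 0 \<or> zeta j = zeta (Suc 0) \<or> zeta j = zeta 2" by (auto simp: zeta_def)
  then show ?thesis
    using root[of "sqrt 3 / 2"] root[of "- (sqrt 3 / 2)"] by (auto simp: zeta_simps)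
qed

lemma norm_zeta: "norm (zeta j) = 1"
proof -
  have "norm (zeta j) ^ 3 = 1 ^ 3" using zeta_cubed[of j] by (metis norm_one norm_power power_one)
  then show ?thesis by (metis norm_ge_zero power_eq_imp_eq_base zero_less_numeral zero_le_one)
qed

lemma zeta_nonzero: "zeta j \<noteq> 0"
  using norm_zeta[of j] by auto

lemma sum_zeta: "(\<Sum>j\<le>2. zeta j) = 0"
  unfolding sum_atMost_2 zeta_simps by (simp add: complex_eq_iff)

lemma sum_zeta_squared: "(\<Sum>j\<le>2. (zeta j)\<^sup>2) = 0"
  unfolding sum_atMost_2 zeta_simps by (simp add: complex_eq_iff power2_eq_square)

lemma inverse_zeta: "1 / zeta j = (zeta j)\<^sup>2" "1 / (zeta j)\<^sup>2 = zeta j"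
  using zeta_cubed[of j] zeta_nonzero[of j] by (auto simp: field_simps power3_eq_cube power2_eq_square)

text \<open>The exponents \<open>\<nu>\<^sub>j\<close> of the solutions \<open>exp (\<nu>\<^sub>j x)\<close> of the unperturbed equation.\<close>

definition exponent :: "complex \<Rightarrow> nat \<Rightarrow> complex" where
  "exponent l j = - \<i> * l * zeta j"

definition kernel_coeff :: "nat \<Rightarrow> complex \<Rightarrow> nat \<Rightarrow> complex" where
  "kernel_coeff r l j = 1 / (3 * exponent l j ^ r)"

lemma sfun_quotient:
  "sfun r (- \<i> * l * of_real s) / (- \<i> * l) ^ r = (\<Sum>j\<le>2. kernel_coeff r l j * exp (exponent l j * of_real s))"
proof -
  define \<mu> where "\<mu> = - \<i> * l"
  show ?thesis
    unfolding sfun_def sum_distrib_left sum_divide_distrib kernel_coeff_def exponent_def \<mu>_def[symmetric]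
    by (intro sum.cong refl) (simp add: power_mult_distrib mult_ac)
qed

lemma exponent_nonzero: "l \<noteq> 0 \<Longrightarrow> exponent l j \<noteq> 0"
  by (simp add: exponent_def zeta_nonzero)

lemma norm_exponent: "norm (exponent l j) = norm l"
  by (simp add: exponent_def norm_mult norm_zeta)

lemma exponent_cubed: "exponent l j ^ 3 = \<i> * l ^ 3"
  by (simp add: exponent_def power_mult_distrib zeta_cubed) (simp add: power3_eq_cube)

lemma kernel_coeff_step: "l \<noteq> 0 \<Longrightarrow> kernel_coeff (Suc r) l j * exponent l j = kernel_coeff r l j"
  by (simp add: kernel_coeff_def exponent_nonzero)

lemma kernel_coeff_0: "kernel_coeff 0 l j * exponent l j = \<i> * l ^ 3 * kernel_coeff 2 l j" if "l \<noteq> 0"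
proof -
  have "\<i> * l ^ 3 = exponent l j * (exponent l j)\<^sup>2"
    unfolding exponent_cubed[of l j, symmetric] by (simp only: power3_eq_cube power2_eq_square mult.assoc)
  then show ?thesis using exponent_nonzero[OF that, of j] by (simp add: kernel_coeff_def)
qed

text \<open>For \<open>\<lambda> \<noteq> 0\<close> these are the values at \<open>0\<close> of the fundamental solution \<open>s\<^sub>2 (-i \<lambda> s) / (-i \<lambda>)\<^sup>2\<close> and of its first and
  second derivative.\<close>

lemma sum_kernel_coeff:
  "(\<Sum>j\<le>2. kernel_coeff 2 l j) = 0" "(\<Sum>j\<le>2. kernel_coeff (Suc 0) l j) = 0" "(\<Sum>j\<le>2. kernel_coeff 0 l j) = 1"
proof -
  have "(\<Sum>j\<le>2. kernel_coeff 2 l j) = (\<Sum>j\<le>2. 1 / (3 * (- \<i> * l)\<^sup>2) * (1 / (zeta j)\<^sup>2))"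
    by (intro sum.cong refl) (simp add: kernel_coeff_def exponent_def power_mult_distrib)
  also have "\<dots> = 1 / (3 * (- \<i> * l)\<^sup>2) * (\<Sum>j\<le>2. zeta j)"
    unfolding inverse_zeta sum_distrib_left ..
  finally show "(\<Sum>j\<le>2. kernel_coeff 2 l j) = 0" by (simp add: sum_zeta)
  have "(\<Sum>j\<le>2. kernel_coeff (Suc 0) l j) = (\<Sum>j\<le>2. 1 / (3 * (- \<i> * l)) * (1 / zeta j))"
    by (intro sum.cong refl) (simp add: kernel_coeff_def exponent_def)
  also have "\<dots> = 1 / (3 * (- \<i> * l)) * (\<Sum>j\<le>2. (zeta j)\<^sup>2)"
    unfolding inverse_zeta sum_distrib_left ..
  finally show "(\<Sum>j\<le>2. kernel_coeff (Suc 0) l j) = 0" by (simp add: sum_zeta_squared)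
  show "(\<Sum>j\<le>2. kernel_coeff 0 l j) = 1" by (simp add: kernel_coeff_def)
qed

lemma norm_sfun_le: "norm (sfun r z) \<le> exp (norm z)"
proof -
  have "norm (sfun r z) \<le> 1 / 3 * (\<Sum>k\<le>2. norm (1 / zeta k ^ r * exp (z * zeta k)))"
    unfolding sfun_def by (simp add: norm_mult norm_sum del: sum_distrib_left)
  also have "\<dots> \<le> 1 / 3 * (\<Sum>k\<le>(2::nat). exp (norm z))"
  proof (intro mult_left_mono sum_mono)
    fix k
    have "norm (exp (z * zeta k)) \<le> exp (norm (z * zeta k))" by (rule norm_exp)
    then show "norm (1 / zeta k ^ r * exp (z * zeta k)) \<le> exp (norm z)"
      unfolding norm_mult norm_divide norm_power norm_zeta by simp
  qed simp
  finally show ?thesis by simp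
qed

lemma sfun_holomorphic [holomorphic_intros]:
  "f holomorphic_on S \<Longrightarrow> (\<lambda>l. sfun r (f l)) holomorphic_on S"
  unfolding sfun_def by (intro holomorphic_intros zeta_nonzero power_not_zero) auto

section \<open>Estimates for the coefficients and kernels\<close>

lemma integrable_exp_minus_abs:
  assumes "c > 0"
  shows "integrable lebesgue (\<lambda>x::real. exp (- c * \<bar>x\<bar>))"
proof -
  have "(\<lambda>x. exp (- c * x)) absolutely_integrable_on {0..}"
    by (intro nonnegative_absolutely_integrable_1 integrable_on_exp_minus_to_infinity assms) auto
  then have E: "integrable lebesgue (\<lambda>x. indicator {0..} x *\<^sub>R exp (- c * x))" (is "integrable _ ?E")
    by (simp add: set_integrable_def)
  then have E': "integrable lebesgue (\<lambda>x. ?E (- x))"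
    using has_bochner_integral_lebesgue_real_affine_iff[of "-1" ?E _ 0]
    by (auto simp: has_bochner_integral_iff)
  have m: "(\<lambda>x::real. exp (- c * \<bar>x\<bar>)) \<in> borel_measurable lebesgue"
    by (intro borel_measurable_lebesgue_continuous continuous_intros)
  show ?thesis
    by (rule Bochner_Integration.integrable_bound[OF Bochner_Integration.integrable_add[OF E E'] m])
       (auto intro!: AE_I2 simp: indicator_def)
qed

text \<open>The weight \<open>exp (a |x|)\<close> in the square mean beats \<open>exp (b |x|)\<close> in the mean for \<open>b < a\<close>: apply
  \<open>u v \<le> u\<^sup>2 + v\<^sup>2\<close> to \<open>u = |f x| exp (a |x|)\<close> and \<open>v = exp (- (a - b) |x|)\<close>.\<close>

lemma integrable_weight_improvement:
  fixes f :: "real \<Rightarrow> real"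
  assumes f: "f \<in> borel_measurable lebesgue" "integrable lebesgue (\<lambda>x. \<bar>f x\<bar>\<^sup>2 * exp (2 * a * \<bar>x\<bar>))" and "b < a"
  shows "integrable lebesgue (\<lambda>x. \<bar>f x\<bar> * exp (b * \<bar>x\<bar>))"
proof (rule Bochner_Integration.integrable_bound)
  show "integrable lebesgue (\<lambda>x. \<bar>f x\<bar>\<^sup>2 * exp (2 * a * \<bar>x\<bar>) + exp (- (2 * (a - b)) * \<bar>x\<bar>))"
    using \<open>b < a\<close> by (intro Bochner_Integration.integrable_add f integrable_exp_minus_abs) auto
  have [measurable]: "(\<lambda>x::real. exp (b * \<bar>x\<bar>)) \<in> borel_measurable lebesgue"
    by (intro borel_measurable_lebesgue_continuous continuous_intros)
  note f(1)[measurable]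
  show "(\<lambda>x. \<bar>f x\<bar> * exp (b * \<bar>x\<bar>)) \<in> borel_measurable lebesgue" by measurable
  show "AE x in lebesgue. norm (\<bar>f x\<bar> * exp (b * \<bar>x\<bar>))
      \<le> norm (\<bar>f x\<bar>\<^sup>2 * exp (2 * a * \<bar>x\<bar>) + exp (- (2 * (a - b)) * \<bar>x\<bar>))"
  proof (rule AE_I2)
    fix x :: real
    define u where "u = \<bar>f x\<bar> * exp (a * \<bar>x\<bar>)"
    define v where "v = exp (- (a - b) * \<bar>x\<bar>)"
    have uv: "0 \<le> u" "0 \<le> v" by (auto simp: u_def v_def)
    have "0 \<le> (u - v)\<^sup>2" by simp
    then have "2 * (u * v) \<le> u\<^sup>2 + v\<^sup>2" by (simp add: power2_diff)
    moreover have "0 \<le> u * v" using uv by simp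
    ultimately have "u * v \<le> u\<^sup>2 + v\<^sup>2" by linarith
    moreover have "u * v = \<bar>f x\<bar> * exp (b * \<bar>x\<bar>)"
      by (simp add: u_def v_def mult_exp_exp algebra_simps)
    moreover have "u\<^sup>2 = \<bar>f x\<bar>\<^sup>2 * exp (2 * a * \<bar>x\<bar>)"
    proof -
      have "exp (2 * a * \<bar>x\<bar>) = (exp (a * \<bar>x\<bar>))\<^sup>2"
        by (simp add: power2_eq_square mult_exp_exp)
      then show ?thesis by (simp only: u_def power_mult_distrib)
    qed
    moreover have "v\<^sup>2 = exp (- (2 * (a - b)) * \<bar>x\<bar>)"
      by (simp add: v_def power2_eq_square flip: exp_add)
    ultimately show "norm (\<bar>f x\<bar> * exp (b * \<bar>x\<bar>))
      \<le> norm (\<bar>f x\<bar>\<^sup>2 * exp (2 * a * \<bar>x\<bar>) + exp (- (2 * (a - b)) * \<bar>x\<bar>))"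
      by simp
  qed
qed

locale jost_coefficients =
  fixes a :: real and p q :: "real \<Rightarrow> real"
  assumes p_C1: "p C1_differentiable_on UNIV"
    and q_measurable: "q \<in> borel_measurable lebesgue"
    and q_weighted: "integrable lebesgue (\<lambda>x. \<bar>q x\<bar>\<^sup>2 * exp (2 * a * \<bar>x\<bar>))"
    and p_weighted: "integrable lebesgue (\<lambda>x. \<bar>p x\<bar>\<^sup>2 * exp (2 * a * \<bar>x\<bar>))"
    and deriv_p_weighted: "integrable lebesgue (\<lambda>x. \<bar>deriv p x\<bar>\<^sup>2 * exp (2 * a * \<bar>x\<bar>))"
begin

lemma p_measurable: "p \<in> borel_measurable lebesgue"
  using C1_differentiable_imp_continuous_on[OF p_C1]
  by (rule borel_measurable_lebesgue_continuous)

lemma deriv_p_measurable: "deriv p \<in> borel_measurable lebesgue"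
proof -
  obtain D where D: "\<And>x. (p has_vector_derivative D x) (at x)" "continuous_on UNIV D"
    using p_C1 unfolding C1_differentiable_on_def by auto
  have "deriv p = D"
    using D(1) by (auto intro!: DERIV_imp_deriv simp: has_real_derivative_iff_has_vector_derivative)
  then show ?thesis using D(2) by (simp add: borel_measurable_lebesgue_continuous)
qed

definition coeff_size :: "real \<Rightarrow> real" where
  "coeff_size x = \<bar>deriv p x\<bar> + \<bar>q x\<bar> + \<bar>p x\<bar>"

lemma coeff_size_nonneg: "0 \<le> coeff_size x"
  by (simp add: coeff_size_def)

lemma coeff_size_integrable: "b < a \<Longrightarrow> integrable lebesgue (\<lambda>x. coeff_size x * exp (b * \<bar>x\<bar>))"
  unfolding coeff_size_def distrib_right
  by (intro Bochner_Integration.integrable_add integrable_weight_improvement[of _ a]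
      p_measurable deriv_p_measurable q_measurable p_weighted q_weighted deriv_p_weighted)

end

lemma kernel1_eq:
  "kernel1 p q l x t =
     (\<Sum>j\<le>2. kernel_coeff 2 l j * exp (exponent l j * of_real (x - t))) * (of_real (deriv p x) + \<i> * of_real (q x))
   + (\<Sum>j\<le>2. kernel_coeff (Suc 0) l j * exp (exponent l j * of_real (x - t))) * (2 * of_real (p x))"
  unfolding kernel1_def sfun_quotient[symmetric] by simp

lemma free_term_eq:
  "free_term p q k l x = exp (exponent l k * of_real x) *
     (of_real (deriv p x) + \<i> * of_real (q x) + 2 * exponent l k * of_real (p x))"
  unfolding free_term_def exponent_def by (simp add: algebra_simps)

text \<open>The inner radius bounds the denominators of the kernels from below, and the condition on the outer
  radius makes the coefficients integrable against \<open>exp (2 r |t|)\<close>.\<close>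

locale jost_annulus = jost_coefficients +
  fixes d r :: real
  assumes d_pos: "0 < d" and r_pos: "0 < r" and r_less: "r < a / 2"
begin

definition \<Omega> :: "complex set" where "\<Omega> = {l. d < norm l \<and> norm l < r}"

definition \<rho> :: "real \<Rightarrow> real" where "\<rho> x = coeff_size x * exp (r * \<bar>x\<bar>)"

definition C :: real where "C = 1 / d\<^sup>2 + 2 / d"

definition h :: "real \<Rightarrow> real" where "h t = C * (coeff_size t * exp (2 * r * \<bar>t\<bar>))"

lemma open_\<Omega>: "open \<Omega>"
  unfolding \<Omega>_def by (intro open_Collect_conj open_Collect_less continuous_intros)

lemma \<Omega>_nonzero: "l \<in> \<Omega> \<Longrightarrow> l \<noteq> 0"
  using d_pos by (auto simp: \<Omega>_def)

lemma C_pos: "0 < C"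
  unfolding C_def using d_pos by (intro add_pos_pos) auto

lemma rho_nonneg: "0 \<le> \<rho> x"
  by (simp add: \<rho>_def coeff_size_nonneg)

lemma h_nonneg: "0 \<le> h t"
  using C_pos by (simp add: h_def coeff_size_nonneg)

lemma rho_exp_le_h: "\<rho> t * exp (r * \<bar>t\<bar>) \<le> h t / C"
  using C_pos by (simp add: \<rho>_def h_def mult.assoc mult_exp_exp)

lemma h_integrable: "integrable lebesgue h"
  unfolding h_def using r_less coeff_size_integrable[of "2 * r"] by (intro integrable_mult_right) auto

lemma norm_exp_exponent_le:
  assumes "l \<in> \<Omega>"
  shows "norm (exp (exponent l j * of_real s)) \<le> exp (r * \<bar>s\<bar>)"
proof -
  have "norm (exponent l j * of_real s) \<le> r * \<bar>s\<bar>"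
    using assms by (auto simp: norm_mult norm_exponent \<Omega>_def intro!: mult_right_mono)
  then show ?thesis using norm_exp[of "exponent l j * of_real s"] by (meson exp_le_cancel_iff order_trans)
qed

lemma norm_sfun_quotient_le:
  assumes "l \<in> \<Omega>" "x \<le> t"
  shows "norm (sfun n (- \<i> * l * of_real (x - t)) / (- \<i> * l) ^ n) \<le> exp (r * (t - x)) / d ^ n"
proof -
  have "norm (- \<i> * l * of_real (x - t)) = norm l * (t - x)"
    using assms(2) by (simp add: norm_mult del: of_real_diff)
  also have "\<dots> \<le> r * (t - x)" using assms by (intro mult_right_mono) (auto simp: \<Omega>_def)
  finally have "norm (sfun n (- \<i> * l * of_real (x - t))) \<le> exp (r * (t - x))"
    using norm_sfun_le[of n "- \<i> * l * of_real (x - t)"] by (meson exp_le_cancel_iff order_trans)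
  moreover have "d ^ n \<le> norm ((- \<i> * l) ^ n)"
    using assms d_pos by (auto simp: norm_power norm_mult \<Omega>_def intro!: power_mono)
  ultimately show ?thesis
    unfolding norm_divide using d_pos by (intro frac_le) auto
qed

text \<open>One factor \<open>exp (r |t|)\<close> is the growth allowed for \<open>w\<close>, the other comes from the kernel. This is
  why the coefficients are measured against \<open>exp (2 r |t|)\<close>.\<close>

lemma exp_shift_le: "exp (r * (t - x)) * exp (r * \<bar>t\<bar>) \<le> exp (r * \<bar>x\<bar>) * exp (2 * r * \<bar>t\<bar>)"
proof -
  have "r * (t - x) + r * \<bar>t\<bar> = r * (t - x + \<bar>t\<bar>)" by (simp add: algebra_simps)
  also have "\<dots> \<le> r * (\<bar>x\<bar> + 2 * \<bar>t\<bar>)" using r_pos by (intro mult_left_mono) auto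
  finally show ?thesis unfolding mult_exp_exp by (simp add: algebra_simps)
qed

lemma norm_kernel1_le:
  assumes "l \<in> \<Omega>" "x \<le> t"
  shows "norm (kernel1 p q l x t) \<le> C * coeff_size x * exp (r * (t - x))"
proof -
  let ?E = "exp (r * (t - x))"
  have "norm (kernel1 p q l x t) \<le> norm (sfun 2 (- \<i> * l * of_real (x - t)) / (- \<i> * l)\<^sup>2 * (of_real (deriv p x) + \<i> * of_real (q x)))
      + norm (sfun 1 (- \<i> * l * of_real (x - t)) / (- \<i> * l) ^ 1 * (2 * of_real (p x)))"
    unfolding kernel1_def power_one_right by (rule norm_triangle_ineq)
  also have "\<dots> \<le> ?E / d\<^sup>2 * (\<bar>deriv p x\<bar> + \<bar>q x\<bar>) + ?E / d ^ 1 * (2 * \<bar>p x\<bar>)"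
    unfolding norm_mult[of "sfun _ _ / _"]
  proof (intro add_mono mult_mono norm_sfun_quotient_le assms)
    show "norm (of_real (deriv p x) + \<i> * complex_of_real (q x)) \<le> \<bar>deriv p x\<bar> + \<bar>q x\<bar>"
      by (rule order_trans[OF norm_triangle_ineq]) (simp add: norm_mult)
  qed (use d_pos in \<open>auto simp: norm_mult\<close>)
  also have "\<dots> \<le> ?E / d\<^sup>2 * coeff_size x + ?E / d ^ 1 * (2 * coeff_size x)"
    using d_pos by (intro add_mono mult_left_mono) (auto simp: coeff_size_def)
  also have "\<dots> = C * coeff_size x * ?E" by (simp add: C_def algebra_simps)
  finally show ?thesis .
qed

lemma kernel1_weighted_le:
  assumes "l \<in> \<Omega>" "x \<le> t"
  shows "norm (kernel1 p q l x t) * \<rho> t \<le> \<rho> x * h t"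
proof -
  have "norm (kernel1 p q l x t) * \<rho> t \<le> (C * coeff_size x * exp (r * (t - x))) * (coeff_size t * exp (r * \<bar>t\<bar>))"
    using mult_right_mono[OF norm_kernel1_le[OF assms] rho_nonneg[of t]] by (simp add: \<rho>_def)
  also have "\<dots> = (C * coeff_size x * coeff_size t) * (exp (r * (t - x)) * exp (r * \<bar>t\<bar>))"
    by (simp add: mult_ac)
  also have "\<dots> \<le> (C * coeff_size x * coeff_size t) * (exp (r * \<bar>x\<bar>) * exp (2 * r * \<bar>t\<bar>))"
    using C_pos coeff_size_nonneg by (intro mult_left_mono exp_shift_le) auto
  also have "\<dots> = \<rho> x * h t" by (simp add: \<rho>_def h_def mult_ac)
  finally show ?thesis .
qed

lemma norm_free_term_le:
  assumes "l \<in> \<Omega>"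
  shows "norm (free_term p q k l x) \<le> (1 + 2 * r) * \<rho> x"
proof -
  have "norm (of_real (deriv p x) + \<i> * of_real (q x) + 2 * exponent l k * of_real (p x))
      \<le> \<bar>deriv p x\<bar> + \<bar>q x\<bar> + 2 * norm l * \<bar>p x\<bar>"
    by (intro order_trans[OF norm_triangle_ineq] add_mono) (auto simp: norm_mult norm_exponent)
  also have "\<dots> \<le> \<bar>deriv p x\<bar> + \<bar>q x\<bar> + 2 * r * \<bar>p x\<bar>"
    using assms by (intro add_left_mono mult_right_mono) (auto simp: \<Omega>_def)
  also have "\<dots> \<le> (1 + 2 * r) * coeff_size x"
    using r_pos by (simp add: coeff_size_def algebra_simps)
  finally have "norm (free_term p q k l x) \<le> exp (r * \<bar>x\<bar>) * ((1 + 2 * r) * coeff_size x)"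
    unfolding free_term_eq norm_mult[of "exp _"] using norm_exp_exponent_le[OF assms]
    by (intro mult_mono) auto
  then show ?thesis by (simp add: \<rho>_def mult_ac)
qed

lemma exponential_convolution:
  assumes l: "l \<in> \<Omega>" and f: "f \<in> borel_measurable lebesgue" and B: "\<And>t. norm (f t) \<le> B * \<rho> t"
  shows "exponential_convolution {..2} (exponent l) f"
proof
  fix j :: nat
  show "integrable lebesgue (\<lambda>t. exp (- exponent l j * of_real t) * f t)"
  proof (rule Bochner_Integration.integrable_bound)
    show "integrable lebesgue (\<lambda>t. \<bar>B\<bar> * (h t / C))" using h_integrable by simp
    have "(\<lambda>t. exp (- exponent l j * complex_of_real t)) \<in> borel_measurable lebesgue"
      by (intro borel_measurable_lebesgue_continuous continuous_intros)
    then show "(\<lambda>t. exp (- exponent l j * of_real t) * f t) \<in> borel_measurable lebesgue"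
      using f by (rule borel_measurable_times)
    show "AE t in lebesgue. norm (exp (- exponent l j * of_real t) * f t) \<le> norm (\<bar>B\<bar> * (h t / C))"
    proof (rule AE_I2)
      fix t :: real
      have "norm (exp (- exponent l j * of_real t) * f t) \<le> exp (r * \<bar>t\<bar>) * (\<bar>B\<bar> * \<rho> t)"
        unfolding norm_mult
      proof (rule mult_mono)
        show "norm (exp (- exponent l j * complex_of_real t)) \<le> exp (r * \<bar>t\<bar>)"
          using norm_exp_exponent_le[OF l, of j "- t"] by simp
        show "norm (f t) \<le> \<bar>B\<bar> * \<rho> t"
          using order_trans[OF B mult_right_mono[OF abs_ge_self rho_nonneg]] .
      qed auto
      also have "\<dots> = \<bar>B\<bar> * (\<rho> t * exp (r * \<bar>t\<bar>))" by simp
      also have "\<dots> \<le> \<bar>B\<bar> * (h t / C)" by (intro mult_left_mono rho_exp_le_h) simp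
      also have "\<dots> \<le> norm (\<bar>B\<bar> * (h t / C))" unfolding real_norm_def by (rule abs_ge_self)
      finally show "norm (exp (- exponent l j * of_real t) * f t) \<le> norm (\<bar>B\<bar> * (h t / C))" .
    qed
  qed
qed simp

text \<open>The integral operator factors through two convolutions with sums of exponentials, multiplied by the
  coefficients of the equation. So it preserves measurability, and the
  fixed point equation takes the form \<open>w = (p' + i q) v + 2 p v'\<close>.\<close>

lemma kernel1_integral:
  assumes "exponential_convolution {..2} (exponent l) f"
  shows "(LINT t:{x..}|lebesgue. kernel1 p q l x t * f t)
    = exponential_convolution.conv {..2} (exponent l) f (kernel_coeff 2 l) x * (of_real (deriv p x) + \<i> * of_real (q x))
      + exponential_convolution.conv {..2} (exponent l) f (kernel_coeff (Suc 0) l) x * (2 * of_real (p x))"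
proof -
  interpret exponential_convolution "{..2}" "exponent l" f by fact
  let ?k = "\<lambda>n t. (\<Sum>j\<le>2. kernel_coeff n l j * exp (exponent l j * of_real (x - t))) * f t"
  let ?c0 = "of_real (deriv p x) + \<i> * complex_of_real (q x)" and ?c1 = "2 * complex_of_real (p x)"
  have int: "set_integrable lebesgue {x..} (\<lambda>t. ?k n t)" for n
    by (rule set_integrable_restrict_UNIV[OF integrable_integrand]) simp
  have "kernel1 p q l x t * f t = ?c0 * ?k 2 t + ?c1 * ?k (Suc 0) t" for t
    unfolding kernel1_eq by (simp add: algebra_simps)
  then have "(LINT t:{x..}|lebesgue. kernel1 p q l x t * f t)
      = (LINT t:{x..}|lebesgue. ?c0 * ?k 2 t + ?c1 * ?k (Suc 0) t)" by simp
  also have "\<dots> = (LINT t:{x..}|lebesgue. ?c0 * ?k 2 t) + (LINT t:{x..}|lebesgue. ?c1 * ?k (Suc 0) t)"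
    by (intro set_integral_add set_integrable_mult_right int)
  also have "\<dots> = ?c0 * conv (kernel_coeff 2 l) x + ?c1 * conv (kernel_coeff (Suc 0) l) x"
    unfolding conv_def by (simp only: set_integral_mult_right)
  finally show ?thesis by (simp add: mult.commute)
qed

lemma weighted_volterra:
  assumes l: "l \<in> \<Omega>"
  shows "weighted_volterra (kernel1 p q l) (free_term p q k l) \<rho> h (1 + 2 * r)"
proof
  have coeffs [measurable]: "(\<lambda>x. of_real (deriv p x) + \<i> * complex_of_real (q x)) \<in> borel_measurable lebesgue"
    "(\<lambda>x. 2 * complex_of_real (p x)) \<in> borel_measurable lebesgue"
    using p_measurable[measurable] deriv_p_measurable[measurable] q_measurable[measurable] by measurable
  have [measurable]: "(\<lambda>x. complex_of_real (deriv p x)) \<in> borel_measurable lebesgue" "(\<lambda>x. complex_of_real (p x)) \<in> borel_measurable lebesgue"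
     "(\<lambda>x. complex_of_real (q x)) \<in> borel_measurable lebesgue"
    using p_measurable[measurable] deriv_p_measurable[measurable] q_measurable[measurable] by measurable
  have [measurable]: "(\<lambda>t. exp (\<nu> * complex_of_real t)) \<in> borel_measurable lebesgue" for \<nu>
    by (intro borel_measurable_lebesgue_continuous continuous_intros)
  have [measurable]: "(\<lambda>t. exp (\<nu> * complex_of_real (x - t))) \<in> borel_measurable lebesgue" for \<nu> x
    by (intro borel_measurable_lebesgue_continuous continuous_intros)
  show "kernel1 p q l x \<in> borel_measurable lebesgue" for x
    unfolding kernel1_eq[abs_def] by measurable
  show "free_term p q k l \<in> borel_measurable lebesgue"
    unfolding free_term_eq[abs_def] by measurable
  fix f :: "real \<Rightarrow> complex" and B :: real
  assume f: "f \<in> borel_measurable lebesgue" "\<And>t. norm (f t) \<le> B * \<rho> t"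
  then have E: "exponential_convolution {..2} (exponent l) f" by (rule exponential_convolution[OF l])
  then interpret exponential_convolution "{..2}" "exponent l" f .
  have [measurable]: "conv \<alpha> \<in> borel_measurable lebesgue" for \<alpha>
    by (intro borel_measurable_lebesgue_continuous conv_continuous)
  show "(\<lambda>x. LINT t:{x..}|lebesgue. kernel1 p q l x t * f t) \<in> borel_measurable lebesgue"
    unfolding kernel1_integral[OF E] by measurable
qed (use l rho_nonneg h_nonneg h_integrable r_pos kernel1_weighted_le norm_free_term_le in auto)

end

section \<open>Jost functions\<close>

definition jost_density :: "(real \<Rightarrow> real) \<Rightarrow> (real \<Rightarrow> real) \<Rightarrow> nat \<Rightarrow> complex \<Rightarrow> real \<Rightarrow> complex" where
  "jost_density p q k l = volterra_solution (kernel1 p q l) (free_term p q k l)"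

definition jost_function :: "(real \<Rightarrow> real) \<Rightarrow> (real \<Rightarrow> real) \<Rightarrow> nat \<Rightarrow> complex \<Rightarrow> real \<Rightarrow> complex" where
  "jost_function p q k l x = exp (- \<i> * l * zeta k * of_real x)
     - (LINT t:{x..}|lebesgue. sfun 2 (- \<i> * l * of_real (x - t)) / (- \<i> * l)\<^sup>2 * jost_density p q k l t)"

context jost_annulus
begin

context
  fixes l :: complex and k :: nat
  assumes l: "l \<in> \<Omega>"
begin

interpretation V: weighted_volterra "kernel1 p q l" "free_term p q k l" \<rho> h "1 + 2 * r"
  by (rule weighted_volterra[OF l])

abbreviation (input) "w \<equiv> jost_density p q k l"

lemma density_measurable: "w \<in> borel_measurable lebesgue"
  unfolding jost_density_def by (rule V.volterra_solution_measurable)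

text \<open>Independent of \<open>l\<close> and \<open>k\<close>, as the holomorphy of the Jost function in \<open>l\<close> requires.\<close>

definition density_bound :: real where
  "density_bound = 2 * (1 + 2 * r) * exp (4 * integral\<^sup>L lebesgue h)"

lemma norm_density_le: "norm (w t) \<le> density_bound * \<rho> t"
  using V.volterra_solution_bound[of t] by (simp add: jost_density_def density_bound_def V.\<phi>_max_def)

lemma density_bound_nonneg: "0 \<le> density_bound"
  using r_pos by (simp add: density_bound_def)

lemma density_convolution: "exponential_convolution {..2} (exponent l) w"
  by (rule exponential_convolution[OF l density_measurable norm_density_le])

interpretation E: exponential_convolution "{..2}" "exponent l" w
  by (rule density_convolution)

lemma density_solves: "integral_eq_solution p q k l w"
  unfolding integral_eq_solution_def jost_density_def
  using V.volterra_solution_integrable V.volterra_solution_eq by blast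

lemma jost_function_eq:
  "jost_function p q k l x = exp (exponent l k * of_real x) - E.conv (kernel_coeff 2 l) x"
  unfolding jost_function_def E.conv_def sfun_quotient exponent_def ..

lemma jost_function_given_by: "given_by_integral k l w (jost_function p q k l)"
proof -
  have "set_integrable lebesgue {x..} (\<lambda>t. sfun 2 (- \<i> * l * of_real (x - t)) / (- \<i> * l)\<^sup>2 * w t)" for x
    unfolding sfun_quotient by (rule set_integrable_restrict_UNIV[OF E.integrable_integrand]) simp
  then show ?thesis unfolding given_by_integral_def jost_function_def by blast
qed

lemma jost_kernel_integrand_le:
  assumes "x \<le> t"
  shows "norm (sfun 2 (- \<i> * l * of_real (x - t)) / (- \<i> * l)\<^sup>2 * w t)
    \<le> density_bound / (d\<^sup>2 * C) * exp (- r * x) * h t"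
proof -
  have "norm (sfun 2 (- \<i> * l * of_real (x - t)) / (- \<i> * l)\<^sup>2 * w t)
      \<le> exp (r * (t - x)) / d\<^sup>2 * (density_bound * \<rho> t)"
    unfolding norm_mult[of "sfun _ _ / _"]
    by (intro mult_mono norm_sfun_quotient_le l assms norm_density_le) auto
  also have "\<dots> = density_bound / d\<^sup>2 * exp (- r * x) * (\<rho> t * exp (r * t))"
    by (simp add: algebra_simps exp_diff exp_minus divide_inverse)
  also have "\<dots> \<le> density_bound / d\<^sup>2 * exp (- r * x) * (h t / C)"
  proof (intro mult_left_mono)
    have "\<rho> t * exp (r * t) \<le> \<rho> t * exp (r * \<bar>t\<bar>)"
      using r_pos rho_nonneg by (intro mult_left_mono) auto
    then show "\<rho> t * exp (r * t) \<le> h t / C" using rho_exp_le_h by (rule order_trans)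
  qed (use density_bound_nonneg in auto)
  finally show ?thesis by (simp add: mult_ac)
qed

lemma jost_function_asymptotics:
  "((\<lambda>x. jost_function p q k l x - exp (- \<i> * l * zeta k * of_real x)) \<longlongrightarrow> 0) at_top"
proof -
  let ?c = "density_bound / (d\<^sup>2 * C)"
  have "((\<lambda>x. ?c * (LINT t:{x..}|lebesgue. h t)) \<longlongrightarrow> ?c * 0) at_top"
    by (intro tendsto_intros tail_integral_tendsto_0 h_integrable)
  then have lim: "((\<lambda>x. ?c * (LINT t:{x..}|lebesgue. h t)) \<longlongrightarrow> 0) at_top" by simp
  show ?thesis
  proof (rule Lim_null_comparison[OF _ lim])
    show "\<forall>\<^sub>F x in at_top. norm (jost_function p q k l x - exp (- \<i> * l * zeta k * of_real x))
        \<le> ?c * (LINT t:{x..}|lebesgue. h t)"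
      using eventually_ge_at_top[of 0]
    proof eventually_elim
      case (elim x)
      have c0: "0 \<le> ?c" using density_bound_nonneg C_pos by simp
      have "norm (LINT t:{x..}|lebesgue. sfun 2 (- \<i> * l * of_real (x - t)) / (- \<i> * l)\<^sup>2 * w t)
          \<le> (LINT t:{x..}|lebesgue. ?c * h t)"
      proof (rule set_integral_mono_norm)
        show "set_integrable lebesgue {x..} (\<lambda>t. ?c * h t)"
          by (intro set_integrable_restrict_UNIV integrable_mult_right h_integrable) simp
        fix t assume "t \<in> {x..}"
        have "?c * exp (- r * x) * h t \<le> ?c * 1 * h t"
          using elim r_pos c0 h_nonneg by (intro mult_right_mono mult_left_mono) auto
        then show "norm (sfun 2 (- \<i> * l * of_real (x - t)) / (- \<i> * l)\<^sup>2 * w t) \<le> ?c * h t"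
          using jost_kernel_integrand_le[of x t] \<open>t \<in> {x..}\<close> by simp
      qed
      also have "(LINT t:{x..}|lebesgue. ?c * h t) = ?c * (LINT t:{x..}|lebesgue. h t)"
        by (rule set_integral_mult_right)
      finally show ?case unfolding jost_function_def by simp
    qed
  qed
qed

text \<open>Multiplying \<open>kernel_coeff (Suc n)\<close> by the exponents gives \<open>kernel_coeff n\<close>, and one step beyond
  \<open>kernel_coeff 0\<close> comes \<open>i \<lambda>\<^sup>3\<close> times \<open>kernel_coeff 2\<close>, since all exponents have the same cube.
  So the third derivative is \<open>i \<lambda>\<^sup>3 v + w\<close>.\<close>

lemma jost_function_ode: "ode_solution p q l (jost_function p q k l)"
proof -
  let ?e = "\<lambda>x. exp (exponent l k * complex_of_real x)"
  let ?\<nu> = "exponent l k"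
  define v1 where "v1 = (\<lambda>x. ?\<nu> * ?e x - E.conv (kernel_coeff (Suc 0) l) x)"
  define v2 where "v2 = (\<lambda>x. ?\<nu> * (?\<nu> * ?e x) - E.conv (kernel_coeff 0 l) x)"
  note l0 = \<Omega>_nonzero[OF l]
  have v: "jost_function p q k l = (\<lambda>x. ?e x - E.conv (kernel_coeff 2 l) x)"
    using jost_function_eq by blast
  have step2: "(\<lambda>j. kernel_coeff 2 l j * exponent l j) = kernel_coeff (Suc 0) l"
    using kernel_coeff_step[OF l0, of "Suc 0"] by (simp add: numeral_2_eq_2 fun_eq_iff)
  have step1: "(\<lambda>j. kernel_coeff (Suc 0) l j * exponent l j) = kernel_coeff 0 l"
    using kernel_coeff_step[OF l0, of 0] by (simp add: fun_eq_iff)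
  have step0: "E.conv (\<lambda>j. kernel_coeff 0 l j * exponent l j) x = \<i> * l ^ 3 * E.conv (kernel_coeff 2 l) x" for x
    unfolding kernel_coeff_0[OF l0] E.conv_eq sum_distrib_left by (simp add: mult_ac)
  have d1: "(jost_function p q k l has_vector_derivative v1 x) (at x)" for x
    unfolding v v1_def
    using E.conv_derivative[OF sum_kernel_coeff(1)[of l], of x] step2
    by (intro has_vector_derivative_diff exp_line_derivative) simp
  have d2: "(v1 has_vector_derivative v2 x) (at x)" for x
    unfolding v1_def v2_def
    using E.conv_derivative[OF sum_kernel_coeff(2)[of l], of x] step1
    by (intro has_vector_derivative_diff has_vector_derivative_mult_right exp_line_derivative) simp
  have "locally_abs_continuous v2"
  proof -
    have "integral_dominated b c (\<lambda>x. ?\<nu> * (?\<nu> * ?e x) + (-1) * E.conv (kernel_coeff 0 l) x)" for b c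
      by (intro integral_dominated_add integral_dominated_mult integral_dominated_const
          integral_dominated_exp E.conv_integral_dominated)
    then show ?thesis
      unfolding locally_abs_continuous_def v2_def
      by (auto intro!: integral_dominated_imp_abs_continuous)
  qed
  moreover have "AE x in lebesgue. (v2 has_vector_derivative
      (\<i> * l ^ 3 * jost_function p q k l x + 2 * of_real (p x) * v1 x
        + (of_real (deriv p x) + \<i> * of_real (q x)) * jost_function p q k l x)) (at x)"
    using E.AE_conv_derivative[of "kernel_coeff 0 l"]
  proof eventually_elim
    case (elim x)
    let ?c0 = "of_real (deriv p x) + \<i> * complex_of_real (q x)"
    have "(v2 has_vector_derivative ?\<nu> * (?\<nu> * (?\<nu> * ?e x)) - (\<i> * l ^ 3 * E.conv (kernel_coeff 2 l) x - w x)) (at x)"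
      unfolding v2_def using elim
      by (intro has_vector_derivative_diff has_vector_derivative_mult_right exp_line_derivative)
         (simp add: step0 sum_kernel_coeff)
    moreover have "?\<nu> * (?\<nu> * (?\<nu> * ?e x)) = \<i> * l ^ 3 * ?e x"
      unfolding exponent_cubed[of l k, symmetric] by (simp add: power3_eq_cube mult_ac)
    moreover have "w x = ?c0 * jost_function p q k l x + 2 * of_real (p x) * v1 x"
    proof -
      have "w x = free_term p q k l x - (LINT t:{x..}|lebesgue. kernel1 p q l x t * w t)"
        using density_solves unfolding integral_eq_solution_def by blast
      moreover have "e * (c + 2 * \<nu> * P) - (k2 * c + k1 * (2 * P)) = c * (e - k2) + 2 * P * (\<nu> * e - k1)"
        for e c \<nu> P k1 k2 :: complex by (simp add: algebra_simps)
      ultimately show ?thesis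
        by (simp only: kernel1_integral[OF density_convolution] free_term_eq jost_function_eq v1_def)
    qed
    moreover have "m * e - (m * k2 - (c * v + P * v1)) = m * (e - k2) + P * v1 + c * v"
      for m e k2 c v P v1 :: complex by (simp add: algebra_simps)
    ultimately show ?case by (simp only: jost_function_eq)
  qed
  ultimately show ?thesis
    unfolding ode_solution_def using d1 d2 by blast
qed

end

lemma density_holomorphic: "(\<lambda>l. jost_density p q k l x) holomorphic_on \<Omega>"
  unfolding jost_density_def
proof (rule volterra_solution_holomorphic[OF open_\<Omega> weighted_volterra])
  show "(\<lambda>l. kernel1 p q l x t) holomorphic_on \<Omega>" for x t
    unfolding kernel1_def by (intro holomorphic_intros) (auto dest: \<Omega>_nonzero)
  show "(\<lambda>l. free_term p q k l x) holomorphic_on \<Omega>" for x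
    unfolding free_term_def by (intro holomorphic_intros)
qed

lemma jost_function_holomorphic: "(\<lambda>l. jost_function p q k l x) holomorphic_on \<Omega>"
proof -
  have "(\<lambda>l. LINT t|lebesgue. indicat_real {x..} t *\<^sub>R
      (sfun 2 (- \<i> * l * of_real (x - t)) / (- \<i> * l)\<^sup>2 * jost_density p q k l t)) holomorphic_on \<Omega>"
  proof (rule holomorphic_on_integral[OF open_\<Omega>])
    show "integrable lebesgue (\<lambda>t. density_bound / (d\<^sup>2 * C) * exp (- r * x) * h t)"
      using h_integrable by simp
    fix l assume l: "l \<in> \<Omega>"
    show "(\<lambda>t. indicat_real {x..} t *\<^sub>R
      (sfun 2 (- \<i> * l * of_real (x - t)) / (- \<i> * l)\<^sup>2 * jost_density p q k l t)) \<in> borel_measurable lebesgue"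
      using jost_function_given_by[OF l, of k] unfolding given_by_integral_def set_integrable_def
      by (blast intro: borel_measurable_integrable)
    fix t
    show "norm (indicat_real {x..} t *\<^sub>R
      (sfun 2 (- \<i> * l * of_real (x - t)) / (- \<i> * l)\<^sup>2 * jost_density p q k l t))
      \<le> density_bound / (d\<^sup>2 * C) * exp (- r * x) * h t"
    proof (cases "x \<le> t")
      case True
      then show ?thesis using jost_kernel_integrand_le[OF l True, of k] by simp
    next
      case False
      then show ?thesis using density_bound_nonneg[OF l] C_pos h_nonneg by simp
    qed
  next
    show "(\<lambda>l. indicat_real {x..} t *\<^sub>R
      (sfun 2 (- \<i> * l * of_real (x - t)) / (- \<i> * l)\<^sup>2 * jost_density p q k l t)) holomorphic_on \<Omega>" for t
      unfolding scaleR_conv_of_real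
      by (intro holomorphic_intros density_holomorphic) (auto dest: \<Omega>_nonzero)
  qed
  then show ?thesis
    unfolding jost_function_def set_lebesgue_integral_def by (intro holomorphic_intros)
qed

end

theorem theorem1p1:
  fixes a :: real and p q :: "real \<Rightarrow> real"
  assumes "a > 0"
    and "p C1_differentiable_on UNIV"
    and "q \<in> borel_measurable lebesgue"
    and "integrable lebesgue (\<lambda>x. \<bar>q x\<bar>\<^sup>2 * exp (2 * a * \<bar>x\<bar>))"
    and "integrable lebesgue (\<lambda>x. \<bar>p x\<bar>\<^sup>2 * exp (2 * a * \<bar>x\<bar>))"
    and "integrable lebesgue (\<lambda>x. \<bar>deriv p x\<bar>\<^sup>2 * exp (2 * a * \<bar>x\<bar>))"
  shows "\<exists>v w :: nat \<Rightarrow> complex \<Rightarrow> real \<Rightarrow> complex.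
    \<forall>k\<in>{0, 1, 2}.
      (\<forall>l\<in>punctured_disc (a / 2).
          jost_solution p q k l (v k l)
        \<and> given_by_integral k l (w k l) (v k l)
        \<and> integral_eq_solution p q k l (w k l))
      \<and> (\<forall>x. (\<lambda>l. v k l x) holomorphic_on punctured_disc (a / 2)
            \<and> (\<lambda>l. w k l x) holomorphic_on punctured_disc (a / 2))"
proof -
  interpret jost_coefficients a p q using assms by unfold_locales
  have annulus: "\<exists>d r. jost_annulus a p q d r \<and> d < norm l \<and> norm l < r" if "l \<in> punctured_disc (a / 2)" for l
  proof (intro exI conjI)
    show "jost_annulus a p q (norm l / 2) ((norm l + a / 2) / 2)"
      using that \<open>a > 0\<close> by unfold_locales (auto simp: punctured_disc_def intro: add_nonneg_pos)
  qed (use that in \<open>auto simp: punctured_disc_def\<close>)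
  \<comment> \<open>The functions are defined without reference to an annulus, so differentiability may be
    checked on any annulus that contains the given point.\<close>
  have local_holomorphy: "F holomorphic_on punctured_disc (a / 2)"
    if F: "\<And>d r. jost_annulus a p q d r \<Longrightarrow> F holomorphic_on jost_annulus.\<Omega> d r" for F
    unfolding holomorphic_on_def
  proof
    fix l assume "l \<in> punctured_disc (a / 2)"
    then obtain d r where dr: "jost_annulus a p q d r" "d < norm l" "norm l < r" using annulus by blast
    interpret jost_annulus a p q d r by fact
    have "l \<in> \<Omega>" using dr by (simp add: \<Omega>_def)
    then have "F field_differentiable at l"
      using F[OF dr(1)] open_\<Omega> holomorphic_on_imp_differentiable_at by blast
    then show "F field_differentiable at l within punctured_disc (a / 2)"
      by (rule field_differentiable_at_within)
  qed
  show ?thesis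
  proof (rule exI[of _ "jost_function p q"], rule exI[of _ "jost_density p q"], intro ballI conjI allI)
    fix k l assume "l \<in> punctured_disc (a / 2)"
    then obtain d r where dr: "jost_annulus a p q d r" "d < norm l" "norm l < r" using annulus by blast
    interpret jost_annulus a p q d r by fact
    have l: "l \<in> \<Omega>" using dr by (simp add: \<Omega>_def)
    show "jost_solution p q k l (jost_function p q k l)"
      unfolding jost_solution_def using jost_function_ode[OF l] jost_function_asymptotics[OF l] by blast
    show "given_by_integral k l (jost_density p q k l) (jost_function p q k l)"
      by (rule jost_function_given_by[OF l])
    show "integral_eq_solution p q k l (jost_density p q k l)"
      by (rule density_solves[OF l])
  next
    fix k x
    show "(\<lambda>l. jost_function p q k l x) holomorphic_on punctured_disc (a / 2)"
      by (rule local_holomorphy) (rule jost_annulus.jost_function_holomorphic)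
    show "(\<lambda>l. jost_density p q k l x) holomorphic_on punctured_disc (a / 2)"
      by (rule local_holomorphy) (rule jost_annulus.density_holomorphic)
  qed
qed

end
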